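(* Let $X$ be a Banach space, $A$ the infinitesimal generator of a $C_0$-semigroup $(S_t)_{t\ge 0}$ on $X$ such that for some $\beta\in\mathbb{R}_+$ we have $\|S_t\|\le e^{\beta t}$ for all $t\ge 0$, and let $K\subset X$ be a nonempty closed subset. Let $\alpha:\mathbb{R}_+\times X\to X$ be measurable, and let $L,C\ge 0$ be constants with $\|\alpha(t,x)-\alpha(t,y)\|\le L\|x-y\|$ and $\|\alpha(t,x)\|\le C(1+\|x\|)$ for all $t\in\mathbb{R}_+$, $x,y\in X$. Let $(t_n)_{n\in\mathbb{N}_0}$ be a strictly increasing sequence with $t_0=0$ and $t_n\to\infty$, and assume that for every $n\in\mathbb{N}_0$ there is a function $a_n:X\to X$ such that $\alpha(t,x)=a_n(x)$ for all $(t,x)\in[t_n,t_{n+1})\times X$. Then for each $\epsilon\ge 0$ the following statements are equivalent: (i) $\liminf_{t\downarrow 0}\frac1t d_K(S_t x+t\alpha(s,x))\le\epsilon$ for all $(s,x)\in\mathbb{R}_+\times K$. (ii) $\liminf_{t\downarrow 0}\frac1t d_K(S_t x+t a_n(x))\le\epsilon$ for all $(n,x)\in\mathbb{N}_0\times K$. (iii) $d_K(\xi(t;s,x))\le e^{(\beta+L)(t-s)}d_K(x)+\varphi_{\beta+L}(t-s)\,\epsilon$ for all $0\le s\le t<\infty$ and $x\in X$. If these conditions are fulfilled, and if there is a constant $B\in\mathbb{R}_+$ such that $\|\alpha(t,x)\|\le B$ for all $(t,x)\in\mathbb{R}_+\times X$, then $$d_K(\xi(t;s,x))\le e^{\beta(t-s)}d_K(x)+\varphi_\beta(t-s)(\epsilon+2B),\quad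 0\le s\le t<\infty,\ x\in X.$$
   Context: $\mathbb{R}_+=[0,\infty)$, $\mathbb{N}_0=\{0,1,2,\dots\}$. $d_K(x):=\inf_{y\in K}\|x-y\|$. For $(s,x)\in\mathbb{R}_+\times X$, $\xi(\cdot;s,x):[s,\infty)\to X$ is the unique mild solution of the time-inhomogeneous equation $\dot\xi(t)=A\xi(t)+\alpha(t,\xi(t))$ started at time $s$ in $x$, i.e. the unique continuous function with $\xi(t;s,x)=S_{t-s}x+\int_s^t S_{t-u}\alpha(u,\xi(u;s,x))\,du$ for all $t\ge s$. For $\gamma\in\mathbb{R}$, $\varphi_\gamma(t):=\int_0^t e^{\gamma(t-s)}\,ds$, $t\in\mathbb{R}_+$. *)

theory Defs
  imports "HOL-Analysis.Analysis"
begin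

text \<open>Only the values \<open>S t\<close> for \<open>t \<ge> 0\<close> are meaningful.\<close>

definition C0_semigroup :: "(real \<Rightarrow> 'a::banach \<Rightarrow>\<^sub>L 'a) \<Rightarrow> bool" where
  "C0_semigroup S \<longleftrightarrow>
     S 0 = id_blinfun \<and>
     (\<forall>s\<ge>0. \<forall>t\<ge>0. S (s + t) = S s o\<^sub>L S t) \<and>
     (\<forall>x. ((\<lambda>t. blinfun_apply (S t) x) \<longlongrightarrow> x) (at_right 0))"

text \<open>The generator is an unbounded operator in general; it is represented by its graph.\<close>

definition infinitesimal_generator :: "(real \<Rightarrow> 'a::banach \<Rightarrow>\<^sub>L 'a) \<Rightarrow> ('a \<times> 'a) set" where
  "infinitesimal_generator S =
     {(x, y). ((\<lambda>h. (blinfun_apply (S h) x - x) /\<^sub>R h) \<longlongrightarrow> y) (at_right 0)}"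

text \<open>
  Bochner integration in the library is restricted to second countable spaces, so the integral
  in the variation of constants formula is the Henstock--Kurzweil one; the two agree for
  piecewise continuous integrands on a compact interval. Integrability is part of the definition.
\<close>

definition is_mild_solution ::
  "(real \<Rightarrow> 'a::banach \<Rightarrow>\<^sub>L 'a) \<Rightarrow> (real \<Rightarrow> 'a \<Rightarrow> 'a) \<Rightarrow> real \<Rightarrow> 'a \<Rightarrow> (real \<Rightarrow> 'a) \<Rightarrow> bool" where
  "is_mild_solution S \<alpha> s x \<xi> \<longleftrightarrow>
     continuous_on {s..} \<xi> \<and>
     (\<forall>t\<ge>s. (\<lambda>u. blinfun_apply (S (t - u)) (\<alpha> u (\<xi> u))) integrable_on {s..t} \<and>
        \<xi> t = blinfun_apply (S (t - s)) x +
          integral {s..t} (\<lambda>u. blinfun_apply (S (t - u)) (\<alpha> u (\<xi> u))))"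

text \<open>
  \<open>mild_solution S \<alpha> s x t\<close> is \<open>\<xi>(t; s, x)\<close>. Restriction to \<open>extensional {s..}\<close> identifies
  functions that agree on \<open>[s, \<infinity>)\<close>, so that the description can be unique.
\<close>

definition mild_solution ::
  "(real \<Rightarrow> 'a::banach \<Rightarrow>\<^sub>L 'a) \<Rightarrow> (real \<Rightarrow> 'a \<Rightarrow> 'a) \<Rightarrow> real \<Rightarrow> 'a \<Rightarrow> real \<Rightarrow> 'a" where
  "mild_solution S \<alpha> s x = (THE \<xi>. \<xi> \<in> extensional {s..} \<and> is_mild_solution S \<alpha> s x \<xi>)"

definition phi :: "real \<Rightarrow> real \<Rightarrow> real" where
  "phi \<gamma> t = integral {0..t} (\<lambda>s. exp (\<gamma> * (t - s)))"

end

(* The only hard implication is that near tangency gives the estimate. Nearest points of K need not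
   exist, so the distance of the solution to K cannot be differentiated directly. Instead one
   follows a trajectory inside K: from a point y of K at time t, tangency produces y' in K at some
   later time t + h with y' = S_h y + h alpha(t, y) up to an error of about h epsilon, and comparison
   with xi(t + h) = S_h xi(t) + h alpha(t, xi(t)) + o(h) costs a factor exp((beta + L) h) and a term
   phi(h) epsilon. These bounds compose exactly, so they survive infinitely many steps; completeness
   of the space and a maximality argument carry the trajectory up to any given time. If alpha is
   bounded by B, the difference of its two values is estimated by 2 B instead of the Lipschitz bound. *)
theory Submission
  imports Defs
begin

subsection \<open>Semigroups and convolution\<close>

text \<open>Tangency is a statement about the lower limit, so it yields some arbitrarily small steps
  \<open>h\<close> with no lower bound on their length: finitely many steps need not reach the
  target time, and their times may accumulate earlier. To restart from an accumulation time, the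
  points of \<open>K\<close> reached so far must converge. The same lack of a rate rules out
  differentiating the solution, whose values need not lie in the domain of the generator. The
  substitute is an expansion relative to \<open>S h\<close>, and it holds at every time, break
  points included, because \<alpha> is constant in time on a short interval to the right of each
  point. This expansion also carries the estimate back to tangency.\<close>

locale quasicontractive_semigroup =
  fixes S :: "real \<Rightarrow> 'a::banach \<Rightarrow>\<^sub>L 'a" and \<beta> :: real
  assumes C0: "C0_semigroup S"
    and beta_nonneg: "\<beta> \<ge> 0"
    and norm_S: "t \<ge> 0 \<Longrightarrow> norm (S t) \<le> exp (\<beta> * t)"
begin

lemma S_0 [simp]: "blinfun_apply (S 0) x = x"
  using C0 by (simp add: C0_semigroup_def)

lemma S_add: "s \<ge> 0 \<Longrightarrow> t \<ge> 0 \<Longrightarrow> blinfun_apply (S (s + t)) x = S s (S t x)"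
  using C0 by (simp add: C0_semigroup_def)

lemma S_diff_split: "u \<le> r \<Longrightarrow> r \<le> t \<Longrightarrow> blinfun_apply (S (t - u)) x = S (t - r) (S (r - u) x)"
  using S_add[of "t - r" "r - u" x] by simp

lemma norm_S_apply:
  assumes "t \<ge> 0"
  shows "norm (S t x) \<le> exp (\<beta> * t) * norm x"
  using norm_blinfun[of "S t" x] mult_right_mono[OF norm_S[OF assms] norm_ge_zero[of x]] by linarith

text \<open>Factoring out the operator of the smaller time leaves an increment at time 0. The bound
  keeps the fixed factor \<open>exp (\<beta> * t)\<close> on either side of \<open>t\<close>, so
  continuity at 0 from the right gives two-sided continuity of orbits.\<close>

lemma norm_S_diff:
  assumes "u \<ge> 0" "t \<ge> 0"
  shows "norm (S u x - S t x) \<le> exp (\<beta> * t) * norm (S \<bar>u - t\<bar> x - x)"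
proof (cases "u \<ge> t")
  case True
  have "S u x - S t x = S t (S (u - t) x - x)"
    using S_add[of t "u - t" x] True assms by (simp add: blinfun.diff_right)
  then show ?thesis
    using norm_S_apply[OF assms(2), of "S (u - t) x - x"] True by simp
next
  case False
  have "S u x - S t x = - S u (S (t - u) x - x)"
    using S_add[of u "t - u" x] False assms by (simp add: blinfun.diff_right)
  then have "norm (S u x - S t x) \<le> exp (\<beta> * u) * norm (S (t - u) x - x)"
    using norm_S_apply[OF assms(1), of "S (t - u) x - x"] by simp
  also have "\<dots> \<le> exp (\<beta> * t) * norm (S (t - u) x - x)"
    using False beta_nonneg by (intro mult_right_mono) (auto intro: mult_left_mono)
  finally show ?thesis using False by (simp add: abs_if)
qed

lemma S_near_0:
  assumes "e > 0"
  obtains d where "d > 0" "\<And>h. 0 \<le> h \<Longrightarrow> h < d \<Longrightarrow> norm (S h x - x) < e"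
proof -
  have "((\<lambda>t. S t x) \<longlongrightarrow> x) (at_right 0)"
    using C0 by (simp add: C0_semigroup_def)
  from tendstoD[OF this assms] obtain d where
    d: "d > 0" "\<And>h. h > 0 \<Longrightarrow> h < d \<Longrightarrow> dist (S h x) x < e"
    unfolding eventually_at_right_field by auto
  have "norm (S h x - x) < e" if "0 \<le> h" "h < d" for h
    using d(2)[of h] that assms by (cases "h = 0") (auto simp: dist_norm)
  with d(1) show ?thesis by (rule that)
qed

text \<open>Only strong continuity is available, so \<open>S (f i)\<close> need not converge in
  operator norm. The exponential bound controls the change of the vector, and the increment estimate
  controls the change of time.\<close>

lemma tendsto_S:
  assumes f: "(f \<longlongrightarrow> t) F" and g: "(g \<longlongrightarrow> x) F"
    and nonneg: "eventually (\<lambda>i. f i \<ge> 0) F" "t \<ge> 0"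
  shows "((\<lambda>i. S (f i) (g i)) \<longlongrightarrow> S t x) F"
proof -
  have lim: "((\<lambda>i. S \<bar>f i - t\<bar> x - x) \<longlongrightarrow> 0) F"
  proof (rule tendstoI)
    fix e :: real assume "e > 0"
    then obtain d where d: "d > 0" "\<And>h. 0 \<le> h \<Longrightarrow> h < d \<Longrightarrow> norm (S h x - x) < e"
      using S_near_0 by blast
    from tendstoD[OF f d(1)] show "eventually (\<lambda>i. dist (S \<bar>f i - t\<bar> x - x) 0 < e) F"
      by (rule eventually_mono) (auto simp: dist_real_def intro: d(2))
  qed
  have "((\<lambda>i. exp (\<beta> * f i) * norm (g i - x) + exp (\<beta> * t) * norm (S \<bar>f i - t\<bar> x - x)) \<longlongrightarrow>
      exp (\<beta> * t) * norm (x - x) + exp (\<beta> * t) * norm (0::'a)) F"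
    by (intro tendsto_intros f g lim)
  then have z: "((\<lambda>i. exp (\<beta> * f i) * norm (g i - x) + exp (\<beta> * t) * norm (S \<bar>f i - t\<bar> x - x)) \<longlongrightarrow> 0) F"
    by simp
  have "((\<lambda>i. S (f i) (g i) - S t x) \<longlongrightarrow> 0) F"
  proof (rule Lim_null_comparison[OF _ z])
    show "eventually (\<lambda>i. norm (S (f i) (g i) - S t x) \<le>
        exp (\<beta> * f i) * norm (g i - x) + exp (\<beta> * t) * norm (S \<bar>f i - t\<bar> x - x)) F"
      using nonneg(1)
    proof eventually_elim
      case (elim i)
      have "S (f i) (g i) - S t x = S (f i) (g i - x) + (S (f i) x - S t x)"
        by (simp add: blinfun.diff_right)
      then have "norm (S (f i) (g i) - S t x) \<le> norm (S (f i) (g i - x)) + norm (S (f i) x - S t x)"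
        by (metis norm_triangle_ineq)
      then show ?case
        using norm_S_apply[OF elim, of "g i - x"] norm_S_diff[OF elim nonneg(2), of x] by linarith
    qed
  qed
  then show ?thesis by (simp add: LIM_zero_iff)
qed

lemma continuous_on_S:
  assumes "continuous_on A f" "continuous_on A g" "\<And>i. i \<in> A \<Longrightarrow> f i \<ge> 0"
  shows "continuous_on A (\<lambda>i. blinfun_apply (S (f i)) (g i))"
  using assms unfolding continuous_on_def
  by (auto intro!: tendsto_S simp: eventually_at_filter)

section \<open>Convolution with the semigroup\<close>

definition convolution :: "(real \<Rightarrow> 'a) \<Rightarrow> real \<Rightarrow> real \<Rightarrow> 'a" where
  "convolution f r t = integral {r..t} (\<lambda>u. S (t - u) (f u))"

text \<open>Integrability makes the variation of constants formula meaningful, and continuity in the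
  end point makes Picard iterates continuous. Both survive gluing of adjacent intervals, so they are
  carried together.\<close>

definition convolvable :: "(real \<Rightarrow> 'a) \<Rightarrow> real \<Rightarrow> real \<Rightarrow> bool" where
  "convolvable f r T \<longleftrightarrow>
     (\<forall>t\<in>{r..T}. (\<lambda>u. S (t - u) (f u)) integrable_on {r..t}) \<and>
     continuous_on {r..T} (convolution f r)"

lemma convolvable_integrable:
  "convolvable f r T \<Longrightarrow> r \<le> t \<Longrightarrow> t \<le> T \<Longrightarrow> (\<lambda>u. S (t - u) (f u)) integrable_on {r..t}"
  by (auto simp: convolvable_def)

lemma convolvable_continuous:
  assumes f: "continuous_on {r..T} f"
  shows "convolvable f r T"
  unfolding convolvable_def
proof (intro conjI ballI)
  fix t assume t: "t \<in> {r..T}"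
  show "(\<lambda>u. S (t - u) (f u)) integrable_on {r..t}"
    using t by (intro integrable_continuous_real continuous_on_S continuous_intros
        continuous_on_subset[OF f]) auto
next
  \<comment> \<open>Truncating the time at 0 gives an integrand that is jointly continuous on a
    fixed interval. For \<open>u > t\<close> it equals \<open>f u\<close>, and that surplus is
    subtracted below.\<close>
  let ?H = "\<lambda>t. integral {r..T} (\<lambda>u. S (max 0 (t - u)) (f u))"
  have H: "continuous_on {r..T} ?H"
  proof -
    have "continuous_on ({r..T} \<times> cbox r T) (\<lambda>(t, u). blinfun_apply (S (max 0 (t - u))) (f u))"
      unfolding case_prod_beta
      by (intro continuous_on_S continuous_intros continuous_on_compose2[OF f]) auto
    from integral_continuous_on_param[OF this] show ?thesis by simp
  qed
  have fi: "f integrable_on {r..T}"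
    using f by (rule integrable_continuous_real)
  have eq: "convolution f r t = ?H t - (integral {r..T} f - integral {r..t} f)"
    if t: "t \<in> {r..T}" for t
  proof -
    have "(\<lambda>u. S (max 0 (t - u)) (f u)) integrable_on {r..T}"
      by (intro integrable_continuous_real continuous_on_S continuous_intros f) auto
    then have "?H t = integral {r..t} (\<lambda>u. S (max 0 (t - u)) (f u))
        + integral {t..T} (\<lambda>u. S (max 0 (t - u)) (f u))"
      using t by (simp add: Henstock_Kurzweil_Integration.integral_combine)
    moreover have "integral {r..t} (\<lambda>u. S (max 0 (t - u)) (f u)) = convolution f r t"
      unfolding convolution_def by (rule integral_cong) auto
    moreover have "integral {t..T} (\<lambda>u. S (max 0 (t - u)) (f u)) = integral {t..T} f"
      by (rule integral_cong) auto
    moreover have "integral {r..t} f + integral {t..T} f = integral {r..T} f"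
      using t fi by (simp add: Henstock_Kurzweil_Integration.integral_combine)
    ultimately show ?thesis by (simp add: algebra_simps)
  qed
  have "continuous_on {r..T} (\<lambda>t. ?H t - (integral {r..T} f - integral {r..t} f))"
    by (intro continuous_intros H indefinite_integral_continuous_1 fi)
  then show "continuous_on {r..T} (convolution f r)"
    by (rule continuous_on_eq) (simp add: eq)
qed

lemma convolvable_refl: "convolvable f r r"
  by (rule convolvable_continuous) simp

text \<open>The right end point is exempt because \<alpha> agrees with \<open>a n\<close> only on a
  half-open interval and may jump at its end.\<close>

lemma convolvable_spike:
  assumes g: "convolvable g r T" and eq: "\<And>u. r \<le> u \<Longrightarrow> u < T \<Longrightarrow> f u = g u"
  shows "convolvable f r T"
proof -
  have "(\<lambda>u. S (t - u) (f u)) integrable_on {r..t}" if "t \<in> {r..T}" for t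
  proof (rule integrable_spike_finite)
    show "(\<lambda>u. S (t - u) (g u)) integrable_on {r..t}"
      using g that by (auto simp: convolvable_def)
    show "finite {T}" by simp
    show "S (t - u) (f u) = S (t - u) (g u)" if "u \<in> {r..t} - {T}" for u
      using that \<open>t \<in> {r..T}\<close> by (simp add: eq)
  qed
  moreover have "convolution g r t = convolution f r t" if "t \<in> {r..T}" for t
    unfolding convolution_def
  proof (rule integral_spike)
    show "negligible {T}" by simp
    show "S (t - u) (f u) = S (t - u) (g u)" if "u \<in> {r..t} - {T}" for u
      using that \<open>t \<in> {r..T}\<close> by (simp add: eq)
  qed
  ultimately show ?thesis
    using g continuous_on_eq[of "{r..T}" "convolution g r" "convolution f r"]
    by (auto simp: convolvable_def)
qed

text \<open>The operator \<open>S (t - r)\<close> splits off from \<open>S (t - u)\<close> for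
  \<open>u\<close> up to \<open>r\<close> and, being bounded and linear, commutes with the
  integral.\<close>

lemma
  assumes "(\<lambda>u. S (r - u) (f u)) integrable_on {s..r}"
    and "(\<lambda>u. S (t - u) (f u)) integrable_on {r..t}"
    and "s \<le> r" "r \<le> t"
  shows convolution_integrable_combine: "(\<lambda>u. S (t - u) (f u)) integrable_on {s..t}"
    and convolution_combine: "convolution f s t = S (t - r) (convolution f s r) + convolution f r t"
proof -
  have lin: "bounded_linear (blinfun_apply (S (t - r)))"
    by (rule blinfun.bounded_linear_right)
  have eq: "S (t - u) (f u) = S (t - r) (S (r - u) (f u))" if "u \<in> {s..r}" for u
    using that assms by (intro S_diff_split) auto
  have 1: "((\<lambda>u. S (t - u) (f u)) has_integral S (t - r) (convolution f s r)) {s..r}"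
    using has_integral_linear[OF integrable_integral[OF assms(1)] lin]
    by (subst has_integral_cong[OF eq]) (auto simp: o_def convolution_def)
  have 2: "((\<lambda>u. S (t - u) (f u)) has_integral convolution f r t) {r..t}"
    using assms(2) by (auto simp: convolution_def)
  from has_integral_combine[OF assms(3,4) 1 2]
  show "(\<lambda>u. S (t - u) (f u)) integrable_on {s..t}"
    "convolution f s t = S (t - r) (convolution f s r) + convolution f r t"
    by (auto simp: convolution_def)
qed

lemma convolvable_combine:
  assumes 1: "convolvable f s r" and 2: "convolvable f r T" and "s \<le> r" "r \<le> T"
  shows "convolvable f s T"
  unfolding convolvable_def
proof (intro conjI ballI)
  fix t assume t: "t \<in> {s..T}"
  show "(\<lambda>u. S (t - u) (f u)) integrable_on {s..t}"
  proof (cases "t \<le> r")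
    case True
    then show ?thesis using 1 t by (auto simp: convolvable_def)
  next
    case False
    with t assms(3) show ?thesis
      using convolvable_integrable[OF 1, of r] convolvable_integrable[OF 2, of t] assms
      by (intro convolution_integrable_combine[of r f s t]) auto
  qed
next
  have eq: "convolution f s t = S (t - r) (convolution f s r) + convolution f r t"
    if "t \<in> {r..T}" for t
    using that assms convolvable_integrable[OF 1, of r] convolvable_integrable[OF 2, of t]
    by (intro convolution_combine) auto
  have "continuous_on {r..T} (\<lambda>t. S (t - r) (convolution f s r) + convolution f r t)"
    using 2 by (intro continuous_intros continuous_on_S) (auto simp: convolvable_def)
  then have "continuous_on {r..T} (convolution f s)"
    by (rule continuous_on_eq) (rule eq[symmetric])
  then have "continuous_on ({s..r} \<union> {r..T}) (convolution f s)"
    using 1 by (intro continuous_on_closed_Un) (auto simp: convolvable_def)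
  then show "continuous_on {s..T} (convolution f s)"
    using assms by (simp add: ivl_disj_un_two_touch)
qed

text \<open>A growth rate \<kappa> above \<beta> is reproduced by the convolution with a gain
  \<open>1 / (\<kappa> - \<beta>)\<close> that is independent of the length of the interval. The
  contribution of the lower end point is negative and is dropped.\<close>

lemma norm_convolution_le:
  assumes int: "(\<lambda>u. S (t - u) (f u)) integrable_on {s..t}" and "s \<le> t"
    and f: "\<And>u. s \<le> u \<Longrightarrow> u \<le> t \<Longrightarrow> norm (f u) \<le> N * exp (\<kappa> * (u - s))" and "\<beta> < \<kappa>" "N \<ge> 0"
  shows "norm (convolution f s t) \<le> N * exp (\<kappa> * (t - s)) / (\<kappa> - \<beta>)"
proof -
  let ?g = "\<lambda>u. N * exp (\<beta> * (t - u) + \<kappa> * (u - s))"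
  let ?G = "\<lambda>u. N * exp (\<beta> * (t - u) + \<kappa> * (u - s)) / (\<kappa> - \<beta>)"
  have G: "(?g has_integral (?G t - ?G s)) {s..t}"
  proof (rule fundamental_theorem_of_calculus)
    fix u
    have "(?G has_real_derivative N * (exp (\<beta> * (t - u) + \<kappa> * (u - s)) * (\<kappa> - \<beta>)) / (\<kappa> - \<beta>)) (at u within {s..t})"
      by (auto intro!: derivative_eq_intros)
    then show "(?G has_vector_derivative ?g u) (at u within {s..t})"
      using assms by (simp add: has_real_derivative_iff_has_vector_derivative)
  qed fact
  have "norm (convolution f s t) \<le> integral {s..t} ?g"
    unfolding convolution_def
  proof (rule integral_norm_bound_integral[OF int])
    show "?g integrable_on {s..t}" using G by blast
    fix u assume u: "u \<in> {s..t}"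
    have "norm (S (t - u) (f u)) \<le> exp (\<beta> * (t - u)) * norm (f u)"
      using u by (intro norm_S_apply) auto
    also have "\<dots> \<le> exp (\<beta> * (t - u)) * (N * exp (\<kappa> * (u - s)))"
      using u by (intro mult_left_mono f) auto
    finally show "norm (S (t - u) (f u)) \<le> ?g u" by (simp add: exp_add mult_ac)
  qed
  also have "\<dots> = ?G t - ?G s" using G by (rule integral_unique)
  also have "\<dots> \<le> ?G t" using assms by simp
  finally show ?thesis by simp
qed

end

subsection \<open>Existence and uniqueness of mild solutions\<close>

locale piecewise_autonomous = quasicontractive_semigroup S \<beta>
  for S :: "real \<Rightarrow> 'a::banach \<Rightarrow>\<^sub>L 'a" and \<beta> :: real +
  fixes \<alpha> :: "real \<Rightarrow> 'a \<Rightarrow> 'a" and L C :: real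
    and \<tau> :: "nat \<Rightarrow> real" and a :: "nat \<Rightarrow> 'a \<Rightarrow> 'a"
  assumes L_nonneg: "L \<ge> 0" and C_nonneg: "C \<ge> 0"
    and lipschitz: "t \<ge> 0 \<Longrightarrow> norm (\<alpha> t x - \<alpha> t y) \<le> L * norm (x - y)"
    and growth: "t \<ge> 0 \<Longrightarrow> norm (\<alpha> t x) \<le> C * (1 + norm x)"
    and tau_mono: "strict_mono \<tau>" and tau_0: "\<tau> 0 = 0"
    and tau_lim: "filterlim \<tau> at_top sequentially"
    and alpha_eq: "t \<in> {\<tau> n..<\<tau> (Suc n)} \<Longrightarrow> \<alpha> t x = a n x"
begin

lemma tau_nonneg: "\<tau> n \<ge> 0"
  using tau_mono tau_0 by (metis strict_mono_less_eq zero_le)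

text \<open>The left end point belongs to its piece, so each \<open>a n\<close> inherits the
  Lipschitz bound, and tangency for all times specializes to the pieces.\<close>

lemma a_eq: "a n x = \<alpha> (\<tau> n) x"
  using tau_mono by (intro alpha_eq[symmetric]) (auto simp: strict_mono_def)

lemma interval_index:
  assumes "t \<ge> 0"
  obtains n where "t \<in> {\<tau> n..<\<tau> (Suc n)}"
proof -
  have "eventually (\<lambda>n. t < \<tau> n) sequentially"
    using tau_lim by (simp add: filterlim_at_top_dense)
  then have ex: "\<exists>n. t < \<tau> n"
    by (auto simp: eventually_sequentially)
  define m where "m = (LEAST n. t < \<tau> n)"
  have m: "t < \<tau> m"
    using LeastI_ex[OF ex] by (simp add: m_def)
  have below: "\<tau> k \<le> t" if "k < m" for k
    using not_less_Least[of k "\<lambda>n. t < \<tau> n"] that by (simp add: m_def)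
  have "m \<noteq> 0" using m tau_0 assms by (intro notI) auto
  then obtain n where "m = Suc n" by (cases m) auto
  with m below[of n] show ?thesis by (intro that[of n]) auto
qed

lemma alpha_right_constant:
  assumes "t \<ge> 0"
  obtains d where "d > 0" "\<And>u x. t \<le> u \<Longrightarrow> u < t + d \<Longrightarrow> \<alpha> u x = \<alpha> t x"
proof -
  obtain n where n: "t \<in> {\<tau> n..<\<tau> (Suc n)}" using interval_index[OF assms] .
  show ?thesis
  proof (rule that[of "\<tau> (Suc n) - t"])
    show "\<alpha> u x = \<alpha> t x" if "t \<le> u" "u < t + (\<tau> (Suc n) - t)" for u x
      using that n alpha_eq[of u n x] alpha_eq[of t n x] by auto
  qed (use n in auto)
qed

lemma convolvable_alpha:
  assumes "0 \<le> s" "s \<le> T" and \<xi>: "continuous_on {s..} \<xi>"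
  shows "convolvable (\<lambda>u. \<alpha> u (\<xi> u)) s T"
proof -
  have "convolvable (\<lambda>u. \<alpha> u (\<xi> u)) s T" if "s \<le> T" "T \<le> \<tau> n" for n T
    using that
  proof (induction n arbitrary: T)
    case 0
    with assms tau_0 have "T = s" by simp
    then show ?case by (simp add: convolvable_refl)
  next
    case (Suc n)
    show ?case
    proof (cases "T \<le> \<tau> n")
      case True
      then show ?thesis using Suc by simp
    next
      case False
      \<comment> \<open>The starting time \<open>s\<close> may lie inside the last piece; then the
        interval before \<open>r\<close> is degenerate.\<close>
      define r where "r = max s (\<tau> n)"
      have r: "s \<le> r" "r \<le> T" "\<tau> n \<le> r" using False Suc by (auto simp: r_def)
      have "convolvable (\<lambda>u. \<alpha> u (\<xi> u)) s r"
      proof (cases "s \<le> \<tau> n")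
        case True
        then show ?thesis using Suc.IH[of "\<tau> n"] by (simp add: r_def max_def)
      next
        case False
        then show ?thesis by (simp add: r_def max_def convolvable_refl)
      qed
      moreover have "convolvable (\<lambda>u. \<alpha> u (\<xi> u)) r T"
      proof (rule convolvable_spike)
        have "L-lipschitz_on UNIV (a n)"
          using lipschitz[OF tau_nonneg] by (intro lipschitz_onI L_nonneg) (simp add: dist_norm a_eq)
        then have "continuous_on UNIV (a n)"
          by (rule lipschitz_on_continuous_on)
        then have "continuous_on {r..T} (\<lambda>u. a n (\<xi> u))"
          by (rule continuous_on_compose2[OF _ continuous_on_subset[OF \<xi>]]) (use r in auto)
        then show "convolvable (\<lambda>u. a n (\<xi> u)) r T" by (rule convolvable_continuous)
        show "\<alpha> u (\<xi> u) = a n (\<xi> u)" if "r \<le> u" "u < T" for u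
          using that r Suc.prems by (intro alpha_eq) auto
      qed
      ultimately show ?thesis using r by (intro convolvable_combine[of _ s r T]) auto
    qed
  qed
  moreover obtain n where "T \<in> {\<tau> n..<\<tau> (Suc n)}"
    using interval_index[of T] assms by auto
  ultimately show ?thesis using assms(2) by (metis atLeastLessThan_iff less_imp_le)
qed

lemma is_mild_solution_iff:
  assumes "s \<ge> 0"
  shows "is_mild_solution S \<alpha> s x \<xi> \<longleftrightarrow> continuous_on {s..} \<xi> \<and>
    (\<forall>t\<ge>s. \<xi> t = S (t - s) x + convolution (\<lambda>u. \<alpha> u (\<xi> u)) s t)"
  using convolvable_integrable[OF convolvable_alpha[OF assms]]
  by (auto simp: is_mild_solution_def convolution_def)

lemma convolution_diff:
  assumes "s \<ge> 0" "s \<le> t" "continuous_on {s..} \<xi>" "continuous_on {s..} \<eta>"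
  shows "convolution (\<lambda>u. \<alpha> u (\<xi> u)) s t - convolution (\<lambda>u. \<alpha> u (\<eta> u)) s t =
      convolution (\<lambda>u. \<alpha> u (\<xi> u) - \<alpha> u (\<eta> u)) s t"
    and "(\<lambda>u. S (t - u) (\<alpha> u (\<xi> u) - \<alpha> u (\<eta> u))) integrable_on {s..t}"
proof -
  note int = convolvable_integrable[OF convolvable_alpha[OF assms(1,2)] assms(2) order_refl]
  show "(\<lambda>u. S (t - u) (\<alpha> u (\<xi> u) - \<alpha> u (\<eta> u))) integrable_on {s..t}"
    using integrable_diff[OF int[OF assms(3)] int[OF assms(4)]] by (simp add: blinfun.diff_right)
  show "convolution (\<lambda>u. \<alpha> u (\<xi> u)) s t - convolution (\<lambda>u. \<alpha> u (\<eta> u)) s t =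
      convolution (\<lambda>u. \<alpha> u (\<xi> u) - \<alpha> u (\<eta> u)) s t"
    using Henstock_Kurzweil_Integration.integral_diff[OF int[OF assms(3)] int[OF assms(4)]]
    by (simp add: convolution_def blinfun.diff_right)
qed

text \<open>The rate \<open>\<beta> + L + 1\<close> exceeds \<beta> by \<open>L + 1\<close>, so the
  Lipschitz factor \<open>L\<close> becomes \<open>L / (L + 1) < 1\<close>. This contraction factor
  is the same for all \<open>t\<close>, which serves both uniqueness and existence without patching
  short intervals.\<close>

lemma norm_convolution_diff_le:
  assumes "s \<ge> 0" "s \<le> t" "continuous_on {s..} \<xi>" "continuous_on {s..} \<eta>"
    and "\<And>u. s \<le> u \<Longrightarrow> u \<le> t \<Longrightarrow> norm (\<xi> u - \<eta> u) \<le> N * exp ((\<beta> + L + 1) * (u - s))" "N \<ge> 0"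
  shows "norm (convolution (\<lambda>u. \<alpha> u (\<xi> u)) s t - convolution (\<lambda>u. \<alpha> u (\<eta> u)) s t) \<le>
    L / (L + 1) * N * exp ((\<beta> + L + 1) * (t - s))"
proof -
  have "norm (convolution (\<lambda>u. \<alpha> u (\<xi> u) - \<alpha> u (\<eta> u)) s t) \<le>
      (L * N) * exp ((\<beta> + L + 1) * (t - s)) / (\<beta> + L + 1 - \<beta>)"
  proof (rule norm_convolution_le)
    fix u assume u: "s \<le> u" "u \<le> t"
    have "norm (\<alpha> u (\<xi> u) - \<alpha> u (\<eta> u)) \<le> L * norm (\<xi> u - \<eta> u)"
      using u assms by (intro lipschitz) auto
    also have "\<dots> \<le> L * (N * exp ((\<beta> + L + 1) * (u - s)))"
      using u L_nonneg assms by (intro mult_left_mono) auto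
    finally show "norm (\<alpha> u (\<xi> u) - \<alpha> u (\<eta> u)) \<le> (L * N) * exp ((\<beta> + L + 1) * (u - s))"
      by (simp add: mult_ac)
  qed (use assms L_nonneg convolution_diff(2)[OF assms(1-4)] in auto)
  then show ?thesis
    by (simp add: convolution_diff[OF assms(1-4)])
qed

lemma mild_solution_unique:
  assumes "s \<ge> 0" "is_mild_solution S \<alpha> s x \<xi>" "is_mild_solution S \<alpha> s x \<eta>" "t \<ge> s"
  shows "\<xi> t = \<eta> t"
proof -
  let ?\<kappa> = "\<beta> + L + 1"
  \<comment> \<open>At a maximum \<open>u0\<close> of the weighted difference, the contraction
    bounds the difference by a proper fraction of itself, so it vanishes there and hence on the
    whole interval.\<close>
  let ?w = "\<lambda>u. norm (\<xi> u - \<eta> u) * exp (- (?\<kappa> * (u - s)))"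
  have cont: "continuous_on {s..} \<xi>" "continuous_on {s..} \<eta>"
    and eq: "\<And>u. u \<ge> s \<Longrightarrow> \<xi> u = S (u - s) x + convolution (\<lambda>u. \<alpha> u (\<xi> u)) s u"
      "\<And>u. u \<ge> s \<Longrightarrow> \<eta> u = S (u - s) x + convolution (\<lambda>u. \<alpha> u (\<eta> u)) s u"
    using assms by (auto simp: is_mild_solution_iff)
  have "continuous_on {s..t} ?w"
    by (intro continuous_intros continuous_on_subset[OF cont(1)] continuous_on_subset[OF cont(2)]) auto
  then obtain u0 where u0: "u0 \<in> {s..t}" "\<And>u. u \<in> {s..t} \<Longrightarrow> ?w u \<le> ?w u0"
    using continuous_attains_sup[of "{s..t}" ?w] assms(4) by auto
  have bound: "norm (\<xi> u - \<eta> u) \<le> ?w u0 * exp (?\<kappa> * (u - s))" if "u \<in> {s..t}" for u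
  proof -
    have "norm (\<xi> u - \<eta> u) = ?w u * exp (?\<kappa> * (u - s))"
      by (simp add: mult.assoc flip: exp_add)
    then show ?thesis using u0(2)[OF that] by (metis exp_ge_zero mult_right_mono)
  qed
  have "norm (\<xi> u0 - \<eta> u0) = norm (convolution (\<lambda>u. \<alpha> u (\<xi> u)) s u0 - convolution (\<lambda>u. \<alpha> u (\<eta> u)) s u0)"
    using eq[of u0] u0(1) by simp
  also have "\<dots> \<le> L / (L + 1) * ?w u0 * exp (?\<kappa> * (u0 - s))"
    using u0(1) assms(1) cont bound by (intro norm_convolution_diff_le) auto
  also have "\<dots> = L / (L + 1) * norm (\<xi> u0 - \<eta> u0)"
    by (simp add: mult.assoc flip: exp_add)
  finally have "norm (\<xi> u0 - \<eta> u0) * (1 / (L + 1)) \<le> 0"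
    using L_nonneg by (simp add: field_simps)
  then have "norm (\<xi> u0 - \<eta> u0) \<le> 0"
    using L_nonneg by (simp add: divide_le_0_iff)
  then show ?thesis using bound[of t] assms(4) by simp
qed

lemma mild_solution_exists:
  assumes s: "s \<ge> 0"
  shows "\<exists>\<xi>. is_mild_solution S \<alpha> s x \<xi>"
proof -
  \<comment> \<open>Picard iteration is a contraction on all of \<open>[s, \<infinity>)\<close> in the norm weighted by
    \<open>exp (- \<kappa> (u - s))\<close>; \<open>lift\<close> removes the weight from a bounded function.\<close>
  define \<kappa> where "\<kappa> = \<beta> + L + 1"
  define lift :: "(real \<Rightarrow>\<^sub>C 'a) \<Rightarrow> real \<Rightarrow> 'a"
    where "lift w u = exp (\<kappa> * (u - s)) *\<^sub>R apply_bcontfun w u" for w u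
  define F where "F w t = S (t - s) x + convolution (\<lambda>u. \<alpha> u (lift w u)) s t" for w t
  \<comment> \<open>Replacing \<open>t\<close> by \<open>max s t\<close> extends the weighted
    iterate by a constant to the left of \<open>s\<close>, which makes it a bounded continuous
    function on the whole line.\<close>
  define \<Phi> where "\<Phi> w t = exp (- \<kappa> * (max s t - s)) *\<^sub>R F w (max s t)" for w t
  have kappa: "\<kappa> > \<beta>" using L_nonneg by (simp add: \<kappa>_def)
  have lift_cont: "continuous_on A (lift w)" for A w
    unfolding lift_def by (intro continuous_intros) auto
  have F_cont: "continuous_on {s..} (F w)" for w
  proof -
    have "continuous_on {s..T} (F w)" if "s \<le> T" for T
      using convolvable_alpha[OF s that lift_cont, of w] unfolding F_def
      by (intro continuous_intros continuous_on_S) (auto simp: convolvable_def)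
    then have *: "continuous_on {s..T} (F w)" for T
      by (cases "s \<le> T") auto
    show ?thesis
      unfolding continuous_on_def
    proof
      fix t assume t: "t \<in> {s..}"
      have "(F w \<longlongrightarrow> F w t) (at t within {s..t + 1})"
        using *[of "t + 1"] t by (auto simp: continuous_on_def)
      moreover have "at t within {s..t + 1} = at t within {s..}"
        by (rule at_within_nhd[of _ "{..<t + 1}"]) auto
      ultimately show "(F w \<longlongrightarrow> F w t) (at t within {s..})" by simp
    qed
  qed
  have \<Phi>_bcontfun: "\<Phi> w \<in> bcontfun" for w
  proof -
    have "continuous_on UNIV (\<Phi> w)"
      unfolding \<Phi>_def by (intro continuous_intros continuous_on_compose2[OF F_cont]) auto
    moreover have "norm (\<Phi> w t) \<le> norm x + C * (1 + norm w) / (\<kappa> - \<beta>)" for t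
    proof -
      define r where "r = max s t"
      have r: "s \<le> r" by (simp add: r_def)
      have "norm (S (r - s) x) \<le> exp (\<beta> * (r - s)) * norm x"
        using r by (intro norm_S_apply) auto
      also have "\<dots> \<le> exp (\<kappa> * (r - s)) * norm x"
        using r kappa by (intro mult_right_mono) (auto intro: mult_right_mono)
      finally have 1: "norm (S (r - s) x) \<le> exp (\<kappa> * (r - s)) * norm x" .
      have 2: "norm (convolution (\<lambda>u. \<alpha> u (lift w u)) s r) \<le>
          C * (1 + norm w) * exp (\<kappa> * (r - s)) / (\<kappa> - \<beta>)"
      proof (rule norm_convolution_le)
        show "(\<lambda>u. S (r - u) (\<alpha> u (lift w u))) integrable_on {s..r}"
          using convolvable_integrable[OF convolvable_alpha[OF s r lift_cont] r] by simp
        fix u assume u: "s \<le> u" "u \<le> r"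
        \<comment> \<open>The summand 1 of the linear growth bound is absorbed into the
          weight.\<close>
        have "1 \<le> exp (\<kappa> * (u - s))"
          using u kappa beta_nonneg by simp
        moreover have "norm (lift w u) \<le> exp (\<kappa> * (u - s)) * norm w"
          using norm_bounded[of w u] by (simp add: lift_def)
        ultimately have "1 + norm (lift w u) \<le> exp (\<kappa> * (u - s)) + exp (\<kappa> * (u - s)) * norm w"
          by (rule add_mono)
        also have "\<dots> = (1 + norm w) * exp (\<kappa> * (u - s))"
          by (simp add: algebra_simps)
        finally have "1 + norm (lift w u) \<le> (1 + norm w) * exp (\<kappa> * (u - s))" .
        then have "C * (1 + norm (lift w u)) \<le> C * ((1 + norm w) * exp (\<kappa> * (u - s)))"
          using C_nonneg by (rule mult_left_mono)
        then show "norm (\<alpha> u (lift w u)) \<le> C * (1 + norm w) * exp (\<kappa> * (u - s))"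
          using growth[of u "lift w u"] u s by simp
      qed (use r kappa C_nonneg in auto)
      have "norm (F w r) \<le> exp (\<kappa> * (r - s)) * (norm x + C * (1 + norm w) / (\<kappa> - \<beta>))"
        unfolding F_def using norm_triangle_le[OF add_mono[OF 1 2]] by (simp add: algebra_simps)
      then have "exp (- \<kappa> * (r - s)) * norm (F w r) \<le>
          exp (- \<kappa> * (r - s)) * (exp (\<kappa> * (r - s)) * (norm x + C * (1 + norm w) / (\<kappa> - \<beta>)))"
        by (rule mult_left_mono) simp
      also have "\<dots> = norm x + C * (1 + norm w) / (\<kappa> - \<beta>)"
        by (simp flip: exp_add mult.assoc)
      finally show ?thesis by (simp add: \<Phi>_def r_def)
    qed
    then have "bounded (range (\<Phi> w))"
      unfolding bounded_iff by blast
    ultimately show ?thesis by (simp add: bcontfun_def)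
  qed
  have "\<exists>!w. Bcontfun (\<Phi> w) = w"
  proof (rule banach_fix_type[of "L / (L + 1)"])
    show "\<forall>v w. dist (Bcontfun (\<Phi> v)) (Bcontfun (\<Phi> w)) \<le> L / (L + 1) * dist v w"
    proof (intro allI dist_bound)
      fix v w t
      define r where "r = max s t"
      have r: "s \<le> r" by (simp add: r_def)
      have "norm (F v r - F w r) =
          norm (convolution (\<lambda>u. \<alpha> u (lift v u)) s r - convolution (\<lambda>u. \<alpha> u (lift w u)) s r)"
        by (simp add: F_def)
      also have "\<dots> \<le> L / (L + 1) * dist v w * exp ((\<beta> + L + 1) * (r - s))"
      proof (rule norm_convolution_diff_le[OF s r lift_cont lift_cont])
        fix u
        have "norm (lift v u - lift w u) = exp (\<kappa> * (u - s)) * dist (v u) (w u)"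
          by (simp add: lift_def dist_norm flip: scaleR_diff_right)
        also have "\<dots> \<le> exp (\<kappa> * (u - s)) * dist v w"
          by (intro mult_left_mono dist_bounded) auto
        finally show "norm (lift v u - lift w u) \<le> dist v w * exp ((\<beta> + L + 1) * (u - s))"
          by (simp add: \<kappa>_def mult_ac)
      qed simp
      finally have "exp (- \<kappa> * (r - s)) * norm (F v r - F w r) \<le>
          exp (- \<kappa> * (r - s)) * (exp (\<kappa> * (r - s)) * (L / (L + 1) * dist v w))"
        by (intro mult_left_mono) (auto simp: \<kappa>_def mult_ac)
      also have "\<dots> = L / (L + 1) * dist v w"
        by (simp flip: exp_add mult.assoc)
      finally have "norm (\<Phi> v t - \<Phi> w t) \<le> L / (L + 1) * dist v w"
        by (simp add: \<Phi>_def r_def flip: scaleR_diff_right)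
      then show "dist (Bcontfun (\<Phi> v) t) (Bcontfun (\<Phi> w) t) \<le> L / (L + 1) * dist v w"
        by (simp add: Bcontfun_inverse \<Phi>_bcontfun dist_norm)
    qed
  qed (use L_nonneg in auto)
  then obtain w where "Bcontfun (\<Phi> w) = w" by blast
  then have w: "w t = \<Phi> w t" for t
    using Bcontfun_inverse[OF \<Phi>_bcontfun[of w]] by simp
  have "lift w t = F w t" if "t \<ge> s" for t
    using that w[of t] by (simp add: lift_def \<Phi>_def max_absorb2 flip: exp_add)
  then have "is_mild_solution S \<alpha> s x (lift w)"
    using lift_cont by (auto simp: is_mild_solution_iff[OF s] F_def)
  then show ?thesis by blast
qed

text \<open>Values before \<open>s\<close> do not enter the equation, so any solution may be
  restricted to \<open>{s..}\<close>; within \<open>extensional {s..}\<close>, uniqueness on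
  \<open>{s..}\<close> is equality of functions, as the definite description requires.\<close>

lemma is_mild_solution_mild_solution:
  assumes s: "s \<ge> 0"
  shows "is_mild_solution S \<alpha> s x (mild_solution S \<alpha> s x)"
proof -
  have cong: "is_mild_solution S \<alpha> s x \<xi>" if "is_mild_solution S \<alpha> s x \<eta>" "\<And>u. u \<ge> s \<Longrightarrow> \<xi> u = \<eta> u"
    for \<xi> \<eta>
  proof -
    have "continuous_on {s..} \<xi>"
      using continuous_on_eq[of "{s..}" \<eta> \<xi>] that by (auto simp: is_mild_solution_def)
    moreover have "convolution (\<lambda>u. \<alpha> u (\<xi> u)) s t = convolution (\<lambda>u. \<alpha> u (\<eta> u)) s t" for t
      unfolding convolution_def by (rule integral_cong) (simp add: that)
    ultimately show ?thesis
      using that by (auto simp: is_mild_solution_iff[OF s])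
  qed
  obtain \<eta> where "is_mild_solution S \<alpha> s x \<eta>"
    using mild_solution_exists[OF s] by blast
  then have "is_mild_solution S \<alpha> s x (restrict \<eta> {s..})"
    by (rule cong) simp
  then have "\<exists>!\<xi>. \<xi> \<in> extensional {s..} \<and> is_mild_solution S \<alpha> s x \<xi>"
    using mild_solution_unique[OF s]
    by (intro ex1I[of _ "restrict \<eta> {s..}"] conjI) (auto intro!: extensionalityI)
  from theI'[OF this] show ?thesis
    by (simp add: mild_solution_def)
qed

end

subsection \<open>The function \<open>phi\<close>\<close>

lemma phi_eq:
  assumes "t \<ge> 0"
  shows "phi \<gamma> t = (if \<gamma> = 0 then t else (exp (\<gamma> * t) - 1) / \<gamma>)"
proof (cases "\<gamma> = 0")
  case True
  then show ?thesis using assms by (simp add: phi_def)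
next
  case False
  have "((\<lambda>s. exp (\<gamma> * (t - s))) has_integral
      (- exp (\<gamma> * (t - t)) / \<gamma>) - (- exp (\<gamma> * (t - 0)) / \<gamma>)) {0..t}"
  proof (rule fundamental_theorem_of_calculus)
    fix s
    have "((\<lambda>s. - exp (\<gamma> * (t - s)) / \<gamma>) has_real_derivative exp (\<gamma> * (t - s))) (at s within {0..t})"
      using False by (auto intro!: derivative_eq_intros)
    then show "((\<lambda>s. - exp (\<gamma> * (t - s)) / \<gamma>) has_vector_derivative exp (\<gamma> * (t - s)))
        (at s within {0..t})"
      by (simp add: has_real_derivative_iff_has_vector_derivative)
  qed fact
  from integral_unique[OF this] show ?thesis
    using False by (simp add: phi_def field_simps)
qed

lemma phi_0 [simp]: "phi \<gamma> 0 = 0"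
  by (simp add: phi_eq)

text \<open>The function \<open>phi \<gamma>\<close> solves \<open>y' = \<gamma> * y + 1\<close>
  with initial value 0. Running this equation for time \<open>s\<close> and then for time
  \<open>t\<close> gives the identity, the source of all exact composition of bounds below.\<close>

lemma phi_add:
  assumes "s \<ge> 0" "t \<ge> 0"
  shows "phi \<gamma> (s + t) = phi \<gamma> t + exp (\<gamma> * t) * phi \<gamma> s"
  using assms by (simp add: phi_eq field_simps flip: exp_add)

text \<open>Turns errors that are linear in the step length into ones that compose by
  \<open>phi_add\<close>.\<close>

lemma phi_ge:
  assumes "\<gamma> \<ge> 0" "t \<ge> 0"
  shows "t \<le> phi \<gamma> t"
  using assms exp_ge_add_one_self[of "\<gamma> * t"] by (simp add: phi_eq field_simps)

lemma phi_nonneg: "\<gamma> \<ge> 0 \<Longrightarrow> t \<ge> 0 \<Longrightarrow> phi \<gamma> t \<ge> 0"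
  using phi_ge[of \<gamma> t] by linarith

lemma phi_mono:
  assumes "\<gamma> \<ge> 0" "0 \<le> s" "s \<le> t"
  shows "phi \<gamma> s \<le> phi \<gamma> t"
  using phi_add[of "t - s" s \<gamma>] phi_nonneg[of \<gamma> "t - s"] assms by simp

text \<open>Shows that \<open>phi \<gamma> t / t\<close> is asymptotically at most 1, which recovers
  \<epsilon> without a factor when tangency is derived from the estimate.\<close>

lemma phi_le:
  assumes "\<gamma> \<ge> 0" "t \<ge> 0"
  shows "phi \<gamma> t \<le> t * exp (\<gamma> * t)"
proof -
  have "integral {0..t} (\<lambda>s. exp (\<gamma> * (t - s))) \<le> integral {0..t} (\<lambda>s. exp (\<gamma> * t))"
    using assms by (intro integral_le integrable_continuous_real continuous_intros)
      (auto intro: mult_left_mono)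
  then show ?thesis using assms by (simp add: phi_def)
qed

lemma continuous_on_phi [continuous_intros]:
  assumes "continuous_on A f" "\<And>x. x \<in> A \<Longrightarrow> f x \<ge> 0"
  shows "continuous_on A (\<lambda>x. phi \<gamma> (f x))"
proof (rule continuous_on_eq)
  show "continuous_on A (\<lambda>x. if \<gamma> = 0 then f x else (exp (\<gamma> * f x) - 1) / \<gamma>)"
    using assms(1) by (cases "\<gamma> = 0") (auto intro!: continuous_intros)
qed (use assms(2) in \<open>simp add: phi_eq\<close>)

subsection \<open>Trajectories in the closed set\<close>

text \<open>A lower limit controls arbitrarily small steps but not all small steps; the strict slack
  \<open>d - c\<close> is the price for an actual step.\<close>

lemma frequently_less_of_Liminf_le:
  fixes f :: "'b \<Rightarrow> real"
  assumes "Liminf F (\<lambda>x. ereal (f x)) \<le> ereal c" "c < d"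
  shows "frequently (\<lambda>x. f x < d) F"
proof (rule ccontr)
  assume "\<not> frequently (\<lambda>x. f x < d) F"
  then have "eventually (\<lambda>x. ereal d \<le> ereal (f x)) F"
    by (simp add: not_frequently not_less)
  then have "ereal d \<le> Liminf F (\<lambda>x. ereal (f x))"
    by (rule Liminf_bounded)
  with assms show False by (metis ereal_less_eq(3) less_le_not_le order_trans)
qed

lemma infdist_lessE:
  assumes "infdist x A < d" "A \<noteq> {}"
  obtains y where "y \<in> A" "dist x y < d"
proof -
  have "\<exists>y\<in>A. dist x y < d"
    using assms by (auto simp: infdist_def cINF_less_iff bdd_below_image_dist)
  then show ?thesis using that by blast
qed

text \<open>A form of the Brezis--Browder ordering principle: each step of the chain is chosen to make at
  least half of the progress that is still possible.\<close>

lemma ordering_progress: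
  fixes f :: "'b \<Rightarrow> real"
  assumes z0: "z0 \<in> V"
    and refl: "\<And>z. z \<in> V \<Longrightarrow> R z z"
    and trans: "\<And>u v w. u \<in> V \<Longrightarrow> v \<in> V \<Longrightarrow> w \<in> V \<Longrightarrow> R u v \<Longrightarrow> R v w \<Longrightarrow> R u w"
    and bound: "\<And>z. z \<in> V \<Longrightarrow> f z \<le> T"
    and mono: "\<And>z w. R z w \<Longrightarrow> f z \<le> f w"
    and chain: "\<And>z. (\<And>n. z n \<in> V) \<Longrightarrow> (\<And>n. R (z n) (z (Suc n))) \<Longrightarrow> \<exists>w\<in>V. \<forall>n. R (z n) w"
    and step: "\<And>z. z \<in> V \<Longrightarrow> f z < T \<Longrightarrow> \<exists>w\<in>V. R z w \<and> f z < f w"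
  shows "\<exists>w\<in>V. f w = T"
proof -
  \<comment> \<open>The condition on \<open>v\<close> says that \<open>f v\<close> reaches at least
    the midpoint between \<open>f z\<close> and the supremum of \<open>f\<close> over all successors
    of \<open>z\<close>. If no successor makes progress, \<open>z\<close> itself qualifies.\<close>
  have half: "\<exists>v. v \<in> V \<and> R z v \<and> (\<forall>w\<in>V. R z w \<longrightarrow> f w \<le> 2 * f v - f z)" if z: "z \<in> V" for z
  proof (cases "\<exists>w\<in>V. R z w \<and> f z < f w")
    case False
    then show ?thesis using refl[OF z] z by (intro exI[of _ z]) force
  next
    case True
    then obtain w0 where w0: "w0 \<in> V" "R z w0" "f z < f w0" by blast
    define \<sigma> where "\<sigma> = (SUP w\<in>{w\<in>V. R z w}. f w)"
    have bdd: "bdd_above (f ` {w\<in>V. R z w})"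
      using bound by (auto intro!: bdd_aboveI)
    have ub: "f w \<le> \<sigma>" if "w \<in> V" "R z w" for w
      unfolding \<sigma>_def using that by (intro cSUP_upper bdd) auto
    have "(f z + \<sigma>) / 2 < \<sigma>" using ub[OF w0(1,2)] w0(3) by simp
    then obtain v where "v \<in> V" "R z v" "(f z + \<sigma>) / 2 < f v"
      using less_cSUP_iff[OF _ bdd, of "(f z + \<sigma>) / 2"] w0 by (auto simp flip: \<sigma>_def)
    then show ?thesis using ub by (intro exI[of _ v]) (fastforce simp: field_simps)
  qed
  have "\<exists>z. \<forall>n. z n \<in> V \<and> R (z n) (z (Suc n)) \<and>
      (\<forall>w\<in>V. R (z n) w \<longrightarrow> f w \<le> 2 * f (z (Suc n)) - f (z n))"
    using dependent_nat_choice[of "\<lambda>_ z. z \<in> V"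
        "\<lambda>_ z v. R z v \<and> (\<forall>w\<in>V. R z w \<longrightarrow> f w \<le> 2 * f v - f z)"] z0 half by blast
  then obtain z where z: "\<And>n. z n \<in> V" "\<And>n. R (z n) (z (Suc n))"
    "\<And>n w. w \<in> V \<Longrightarrow> R (z n) w \<Longrightarrow> f w \<le> 2 * f (z (Suc n)) - f (z n)"
    by blast
  from chain[of z, OF z(1,2)] obtain w where w: "w \<in> V" "\<And>n. R (z n) w" by blast
  have "f w = T"
  proof (rule ccontr)
    assume "f w \<noteq> T"
    with bound[OF w(1)] step[OF w(1)] obtain v where v: "v \<in> V" "R w v" "f w < f v" by force
    have Rv: "R (z n) v" for n using trans z(1) w v by blast
    have "incseq (\<lambda>n. f (z n))" using mono z(2) by (intro incseq_SucI) blast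
    then obtain l where l: "(\<lambda>n. f (z n)) \<longlonglongrightarrow> l" "\<forall>n. f (z n) \<le> l"
      by (rule incseq_convergent[of _ "f w"]) (use mono w in blast)
    have "l \<le> f w"
      by (rule LIMSEQ_le_const2[OF l(1)]) (use mono w in blast)
    \<comment> \<open>Since \<open>v\<close> succeeds every \<open>z n\<close>, the midpoint
      property bounds \<open>f v\<close> at every stage. In the limit this gives
      \<open>f v \<le> l\<close>, so \<open>w\<close> could not be improved.\<close>
    moreover have "f v \<le> 2 * l - l"
      by (rule LIMSEQ_le_const[OF tendsto_diff[OF tendsto_mult[OF tendsto_const LIMSEQ_Suc[OF l(1)]] l(1)]])
        (use z(3)[OF v(1) Rv] in blast)
    ultimately show False using v(3) by simp
  qed
  with w(1) show ?thesis by blast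
qed

text \<open>The comparison point may depend on \<open>e\<close>: it will be an early point of a
  chain, transported by the semigroup to the limit time.\<close>

lemma Cauchy_of_near_points:
  fixes y :: "nat \<Rightarrow> 'b::metric_space"
  assumes "\<And>e. e > 0 \<Longrightarrow> \<exists>w. eventually (\<lambda>n. dist (y n) w < e) sequentially"
  shows "Cauchy y"
proof (rule metric_CauchyI)
  fix e :: real assume "e > 0"
  with assms[of "e / 2"] obtain w N where "\<And>n. n \<ge> N \<Longrightarrow> dist (y n) w < e / 2"
    by (auto simp: eventually_sequentially)
  then show "\<exists>N. \<forall>m\<ge>N. \<forall>n\<ge>N. dist (y m) (y n) < e"
    by (metis dist_triangle_half_l)
qed

section \<open>Chains with controlled deviation from the semigroup\<close>

context quasicontractive_semigroup
begin

text \<open>The jump of a trajectory is measured against \<open>S h y\<close> and not against \<open>y\<close>, since orbits of the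
  semigroup are in general not Lipschitz in time. The factor \<open>phi \<beta>\<close> makes the relation transitive.\<close>

definition rate_le :: "real \<Rightarrow> real \<times> 'a \<Rightarrow> real \<times> 'a \<Rightarrow> bool" where
  "rate_le M z w \<longleftrightarrow> fst z \<le> fst w \<and>
     norm (snd w - S (fst w - fst z) (snd z)) \<le> M * phi \<beta> (fst w - fst z)"

lemma rate_le_refl: "rate_le M z z"
  by (simp add: rate_le_def)

lemma rate_le_trans:
  assumes "rate_le M u v" "rate_le M v w"
  shows "rate_le M u w"
proof -
  obtain p x q y r z where [simp]: "u = (p, x)" "v = (q, y)" "w = (r, z)"
    by (cases u, cases v, cases w)
  have le: "p \<le> q" "q \<le> r"
    and 1: "norm (y - S (q - p) x) \<le> M * phi \<beta> (q - p)"
    and 2: "norm (z - S (r - q) y) \<le> M * phi \<beta> (r - q)"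
    using assms by (auto simp: rate_le_def)
  have "z - S (r - p) x = (z - S (r - q) y) + S (r - q) (y - S (q - p) x)"
    using le S_diff_split[of p q r x] by (simp add: blinfun.diff_right)
  then have "norm (z - S (r - p) x) \<le> norm (z - S (r - q) y) + norm (S (r - q) (y - S (q - p) x))"
    by (metis norm_triangle_ineq)
  also have "\<dots> \<le> M * phi \<beta> (r - q) + exp (\<beta> * (r - q)) * (M * phi \<beta> (q - p))"
  proof (rule add_mono[OF 2])
    have "norm (S (r - q) (y - S (q - p) x)) \<le> exp (\<beta> * (r - q)) * norm (y - S (q - p) x)"
      using le by (intro norm_S_apply) auto
    also have "\<dots> \<le> exp (\<beta> * (r - q)) * (M * phi \<beta> (q - p))"
      using 1 by (rule mult_left_mono) simp
    finally show "norm (S (r - q) (y - S (q - p) x)) \<le> exp (\<beta> * (r - q)) * (M * phi \<beta> (q - p))" .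
  qed
  also have "\<dots> = M * phi \<beta> (r - p)"
    using phi_add[of "q - p" "r - q" \<beta>] le by (simp add: algebra_simps)
  finally show ?thesis using le by (simp add: rate_le_def)
qed

text \<open>The times increase to some \<open>r\<close>. For fixed \<open>m\<close>, later points
  stay within \<open>M * phi \<beta> (r - t m)\<close> of the orbit of \<open>y m\<close>, which is
  continuous up to \<open>r\<close>. This radius tends to 0 with \<open>m\<close>, so the points are
  Cauchy, and the relation passes to the limit.\<close>

lemma rate_le_limit:
  assumes z: "\<And>n. rate_le M (z n) (z (Suc n))" and bound: "\<And>n. fst (z n) \<le> T" and "M \<ge> 0"
  obtains w where "z \<longlonglongrightarrow> w" "\<And>n. rate_le M (z n) w"
proof -
  define t y where "t n = fst (z n)" and "y n = snd (z n)" for n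
  have R: "rate_le M (z m) (z n)" if "m \<le> n" for m n
    using that by (induction n rule: dec_induct) (auto intro: rate_le_refl rate_le_trans z)
  then have inc: "incseq t"
    by (auto simp: incseq_def rate_le_def t_def)
  then obtain r where r: "t \<longlonglongrightarrow> r" "\<forall>n. t n \<le> r"
    by (rule incseq_convergent[of _ T]) (use bound in \<open>auto simp: t_def\<close>)
  have near: "norm (y n - S (t n - t m) (y m)) \<le> M * phi \<beta> (t n - t m)" if "m \<le> n" for m n
    using R[OF that] by (simp add: rate_le_def t_def y_def)
  have S_lim: "(\<lambda>n. S (t n - t m) (y m)) \<longlonglongrightarrow> S (r - t m) (y m)" for m
    by (rule tendsto_S) (use inc r in \<open>auto intro!: tendsto_intros eventually_sequentiallyI[of m] simp: incseq_def\<close>)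
  have phi_lim: "(\<lambda>n. phi \<beta> (r - t n)) \<longlonglongrightarrow> phi \<beta> 0"
  proof (rule continuous_on_tendsto_compose[of "{0..}" "phi \<beta>"])
    show "(\<lambda>n. r - t n) \<longlonglongrightarrow> 0" using tendsto_diff[OF tendsto_const r(1), of r] by simp
  qed (use r in \<open>auto intro!: continuous_intros\<close>)
  have "Cauchy y"
  proof (rule Cauchy_of_near_points)
    fix e :: real assume e: "e > 0"
    have "(\<lambda>n. M * phi \<beta> (r - t n)) \<longlonglongrightarrow> 0"
      using tendsto_mult[OF tendsto_const phi_lim, of M] by simp
    from order_tendstoD(2)[OF this, of "e / 2"] e obtain m where m: "M * phi \<beta> (r - t m) < e / 2"
      by (auto simp: eventually_sequentially)
    have "eventually (\<lambda>n. dist (S (t n - t m) (y m)) (S (r - t m) (y m)) < e / 2) sequentially"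
      by (rule tendstoD[OF S_lim]) (use e in simp)
    with eventually_ge_at_top[of m]
    have "eventually (\<lambda>n. dist (y n) (S (r - t m) (y m)) < e) sequentially"
    proof eventually_elim
      case (elim n)
      have "t m \<le> t n" "t n \<le> r" using inc elim r by (auto simp: incseq_def)
      then have "M * phi \<beta> (t n - t m) \<le> M * phi \<beta> (r - t m)"
        using \<open>M \<ge> 0\<close> beta_nonneg by (intro mult_left_mono phi_mono) auto
      then have "dist (y n) (S (t n - t m) (y m)) < e / 2"
        using near[OF elim(1)] m by (simp add: dist_norm)
      with elim(2) show ?case
        using dist_triangle[of "y n" "S (r - t m) (y m)" "S (t n - t m) (y m)"] by simp
    qed
    then show "\<exists>w. eventually (\<lambda>n. dist (y n) w < e) sequentially" by blast
  qed
  then obtain v where v: "y \<longlonglongrightarrow> v"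
    using Cauchy_convergent_iff convergent_def by blast
  have "rate_le M (z m) (r, v)" for m
  proof -
    have 1: "(\<lambda>n. norm (y n - S (t n - t m) (y m))) \<longlonglongrightarrow> norm (v - S (r - t m) (y m))"
      by (intro tendsto_intros v S_lim)
    have 2: "(\<lambda>n. M * phi \<beta> (t n - t m)) \<longlonglongrightarrow> M * phi \<beta> (r - t m)"
    proof (rule tendsto_mult[OF tendsto_const])
      show "(\<lambda>n. phi \<beta> (t n - t m)) \<longlonglongrightarrow> phi \<beta> (r - t m)"
        by (rule continuous_on_tendsto_compose[of "{0..}" "phi \<beta>"])
          (use r inc in \<open>auto intro!: continuous_intros tendsto_intros eventually_sequentiallyI[of m]
            simp: incseq_def\<close>)
    qed
    have "norm (v - S (r - t m) (y m)) \<le> M * phi \<beta> (r - t m)"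
      by (rule LIMSEQ_le[OF 1 2]) (use near in blast)
    then show ?thesis using r(2) by (simp add: rate_le_def t_def y_def)
  qed
  moreover have "z \<longlonglongrightarrow> (r, v)"
    using tendsto_Pair[OF r(1) v] by (simp add: t_def y_def)
  ultimately show ?thesis using that by blast
qed

end

section \<open>Expansion of mild solutions and comparison with points of \<open>K\<close>\<close>

context piecewise_autonomous
begin

text \<open>By the semigroup property, the deviation of \<open>\<xi> (t + h)\<close> from
  \<open>S h (\<xi> t)\<close> is a convolution over \<open>{t..t + h}\<close> alone. There \<alpha>
  is frozen at time \<open>t\<close>, and its integrand is close to the constant
  \<open>\<alpha> t (\<xi> t)\<close>.\<close>

lemma mild_solution_expansion:
  assumes s: "s \<ge> 0" and mild: "is_mild_solution S \<alpha> s x \<xi>" and t: "t \<ge> s" and e: "e > 0"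
  shows "eventually (\<lambda>h. norm (\<xi> (t + h) - S h (\<xi> t) - h *\<^sub>R \<alpha> t (\<xi> t)) \<le> e * h) (at_right 0)"
proof -
  let ?f = "\<lambda>u. \<alpha> u (\<xi> u)"
  define v where "v = \<alpha> t (\<xi> t)"
  have cont: "continuous_on {s..} \<xi>"
    and eq: "\<And>u. u \<ge> s \<Longrightarrow> \<xi> u = S (u - s) x + convolution ?f s u"
    using mild by (auto simp: is_mild_solution_iff[OF s])
  have t0: "t \<ge> 0" using s t by simp
  obtain d1 where d1: "d1 > 0" "\<And>u x. t \<le> u \<Longrightarrow> u < t + d1 \<Longrightarrow> \<alpha> u x = \<alpha> t x"
    using alpha_right_constant[OF t0] by blast
  obtain d2 where d2: "d2 > 0" "\<And>h. 0 \<le> h \<Longrightarrow> h < d2 \<Longrightarrow> norm (S h v - v) < e / 2"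
    using S_near_0[of "e / 2" v] e by auto
  \<comment> \<open>Chosen so that \<open>exp \<beta> * ((L + 1) * q) = e / 2\<close>;
    \<open>L + 1\<close> avoids division by zero, and \<open>exp \<beta>\<close> bounds the
    semigroup since \<open>d\<close> is at most 1.\<close>
  define q where "q = e / (2 * exp \<beta> * (L + 1))"
  have "q > 0" using e L_nonneg by (simp add: q_def)
  then obtain d3 where d3: "d3 > 0" "\<And>u. u \<in> {s..} \<Longrightarrow> dist u t < d3 \<Longrightarrow> dist (\<xi> u) (\<xi> t) < q"
    using cont t unfolding continuous_on_iff by (metis atLeast_iff)
  define d where "d = min (min d1 d2) (min d3 1)"
  have d: "d > 0" "d \<le> d1" "d \<le> d2" "d \<le> d3" "d \<le> 1" using d1 d2 d3 by (auto simp: d_def)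
  have "norm (\<xi> (t + h) - S h (\<xi> t) - h *\<^sub>R v) \<le> e * h" if h: "0 < h" "h < d" for h
  proof -
    note conv = convolvable_integrable[OF convolvable_alpha, OF _ _ _ _ order_refl]
    have int1: "(\<lambda>u. S (t - u) (?f u)) integrable_on {s..t}"
      using s t by (intro conv cont) auto
    have int2: "(\<lambda>u. S (t + h - u) (?f u)) integrable_on {t..t + h}"
      using t0 t h by (intro conv continuous_on_subset[OF cont]) auto
    have "\<xi> (t + h) = S (t + h - s) x + (S h (convolution ?f s t) + convolution ?f t (t + h))"
      using eq[of "t + h"] convolution_combine[OF int1 int2] t h by simp
    moreover have "S (t + h - s) x = S h (S (t - s) x)"
      using S_diff_split[of s t "t + h" x] t h by simp
    ultimately have xi: "\<xi> (t + h) - S h (\<xi> t) = convolution ?f t (t + h)"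
      using eq[OF t] by (simp add: blinfun.add_right)
    have const: "((\<lambda>u. v) has_integral h *\<^sub>R v) {t..t + h}"
      using has_integral_const_real[of v t "t + h"] h by simp
    have "norm (integral {t..t + h} (\<lambda>u. S (t + h - u) (?f u) - v)) \<le> integral {t..t + h} (\<lambda>u. e)"
    proof (rule integral_norm_bound_integral)
      show "(\<lambda>u. S (t + h - u) (?f u) - v) integrable_on {t..t + h}"
        using const by (intro integrable_diff int2) blast
      fix u assume u: "u \<in> {t..t + h}"
      have "S (t + h - u) (?f u) - v = S (t + h - u) (\<alpha> t (\<xi> u) - v) + (S (t + h - u) v - v)"
        using d1(2)[of u "\<xi> u"] u h d by (simp add: blinfun.diff_right)
      then have "norm (S (t + h - u) (?f u) - v) \<le>
          norm (S (t + h - u) (\<alpha> t (\<xi> u) - v)) + norm (S (t + h - u) v - v)"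
        by (metis norm_triangle_ineq)
      moreover have "norm (S (t + h - u) v - v) < e / 2"
        using u h d by (intro d2) auto
      moreover have "norm (S (t + h - u) (\<alpha> t (\<xi> u) - v)) \<le> exp \<beta> * ((L + 1) * q)"
      proof -
        have "norm (\<alpha> t (\<xi> u) - v) \<le> L * norm (\<xi> u - \<xi> t)"
          unfolding v_def by (rule lipschitz[OF t0])
        also have "\<dots> \<le> (L + 1) * q"
          using d3(2)[of u] u h d t L_nonneg by (intro mult_mono) (auto simp: dist_norm)
        finally have 1: "norm (\<alpha> t (\<xi> u) - v) \<le> (L + 1) * q" .
        have 2: "exp (\<beta> * (t + h - u)) \<le> exp \<beta>"
          using u h d beta_nonneg mult_left_mono[of "t + h - u" 1 \<beta>] by simp
        have "norm (S (t + h - u) (\<alpha> t (\<xi> u) - v)) \<le>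
            exp (\<beta> * (t + h - u)) * norm (\<alpha> t (\<xi> u) - v)"
          using u by (intro norm_S_apply) auto
        also have "\<dots> \<le> exp \<beta> * ((L + 1) * q)"
          using 1 2 by (intro mult_mono) auto
        finally show ?thesis .
      qed
      moreover have "exp \<beta> * ((L + 1) * q) = e / 2"
        using L_nonneg by (simp add: q_def)
      ultimately show "norm (S (t + h - u) (?f u) - v) \<le> e" by simp
    qed auto
    moreover have "integral {t..t + h} (\<lambda>u. S (t + h - u) (?f u) - v) =
        convolution ?f t (t + h) - h *\<^sub>R v"
      unfolding convolution_def using integral_unique[OF const] const
      by (subst Henstock_Kurzweil_Integration.integral_diff[OF int2]) auto
    ultimately show ?thesis using h by (simp add: xi mult.commute)
  qed
  then show ?thesis
    unfolding eventually_at_right_field v_def using d(1) by (intro exI[of _ d]) auto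
qed

end

text \<open>The pair \<open>l\<close>, \<open>b\<close> lets one argument yield both estimates:
  \<open>l = L\<close>, \<open>b = 0\<close> in general, and \<open>l = 0\<close>,
  \<open>b = 2 * B\<close> when \<alpha> is bounded by \<open>B\<close>. The constant
  \<open>L\<close> remains responsible for existence and for the expansion.\<close>

locale nearly_tangent = piecewise_autonomous +
  fixes K :: "'a set" and \<epsilon> l b :: real
  assumes closed_K: "closed K" and K_nonempty: "K \<noteq> {}"
    and eps_nonneg: "\<epsilon> \<ge> 0" and l_nonneg: "l \<ge> 0" and b_nonneg: "b \<ge> 0"
    and tangent: "\<lbrakk>s \<ge> 0; x \<in> K\<rbrakk> \<Longrightarrow>
      Liminf (at_right 0) (\<lambda>t. ereal (1 / t * infdist (S t x + t *\<^sub>R \<alpha> s x) K)) \<le> ereal \<epsilon>"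
    and modulus: "t \<ge> 0 \<Longrightarrow> norm (\<alpha> t x - \<alpha> t y) \<le> l * norm (x - y) + b"
begin

text \<open>The first bound keeps the deviation from the semigroup under control, so that chains
  converge; the second propagates the distance to the solution.\<close>

lemma one_step:
  assumes s: "s \<ge> 0" and mild: "is_mild_solution S \<alpha> s x \<xi>" and t: "s \<le> t" "t < T"
    and y: "y \<in> K" and \<eta>: "\<eta> > 0"
  obtains h y' where "h > 0" "t + h \<le> T" "y' \<in> K"
    "norm (y' - S h y) \<le> h * (norm (\<alpha> t y) + \<epsilon> + \<eta>)"
    "norm (\<xi> (t + h) - y') \<le> exp ((\<beta> + l) * h) * norm (\<xi> t - y) + phi (\<beta> + l) h * (\<epsilon> + b + \<eta>)"
proof -
  have t0: "t \<ge> 0" using s t by simp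
  \<comment> \<open>Half of \<eta> pays for the lower limit and for choosing a point of
    \<open>K\<close>, the other half for the remainder of the expansion.\<close>
  have "frequently (\<lambda>h. 1 / h * infdist (S h y + h *\<^sub>R \<alpha> t y) K < \<epsilon> + \<eta> / 2) (at_right 0)"
    by (rule frequently_less_of_Liminf_le[OF tangent[OF t0 y]]) (use \<eta> in simp)
  moreover have "eventually (\<lambda>h. norm (\<xi> (t + h) - S h (\<xi> t) - h *\<^sub>R \<alpha> t (\<xi> t)) \<le> \<eta> / 2 * h \<and>
      h > 0 \<and> h < T - t) (at_right 0)"
  proof (rule eventually_conj)
    show "eventually (\<lambda>h. norm (\<xi> (t + h) - S h (\<xi> t) - h *\<^sub>R \<alpha> t (\<xi> t)) \<le> \<eta> / 2 * h) (at_right 0)"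
      using \<eta> by (intro mild_solution_expansion[OF s mild t(1)]) auto
    show "eventually (\<lambda>h. h > 0 \<and> h < T - t) (at_right 0)"
      using t(2) unfolding eventually_at_right_field by (intro exI[of _ "T - t"]) auto
  qed
  ultimately have "frequently (\<lambda>h. 1 / h * infdist (S h y + h *\<^sub>R \<alpha> t y) K < \<epsilon> + \<eta> / 2 \<and>
      norm (\<xi> (t + h) - S h (\<xi> t) - h *\<^sub>R \<alpha> t (\<xi> t)) \<le> \<eta> / 2 * h \<and> h > 0 \<and> h < T - t) (at_right 0)"
    by (rule frequently_eventually_frequently)
  then obtain h where h: "1 / h * infdist (S h y + h *\<^sub>R \<alpha> t y) K < \<epsilon> + \<eta> / 2"
      "norm (\<xi> (t + h) - S h (\<xi> t) - h *\<^sub>R \<alpha> t (\<xi> t)) \<le> \<eta> / 2 * h" "h > 0" "h < T - t"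
    by (auto dest!: frequently_ex)
  have "infdist (S h y + h *\<^sub>R \<alpha> t y) K < h * (\<epsilon> + \<eta> / 2)"
    using h(1,3) by (simp add: field_simps)
  then obtain y' where y': "y' \<in> K" "norm (S h y + h *\<^sub>R \<alpha> t y - y') < h * (\<epsilon> + \<eta> / 2)"
    using infdist_lessE K_nonempty by (metis dist_norm)
  show ?thesis
  proof (rule that)
    show "h > 0" "t + h \<le> T" "y' \<in> K" using h y' by auto
    have "y' - S h y = h *\<^sub>R \<alpha> t y - (S h y + h *\<^sub>R \<alpha> t y - y')" by simp
    then have "norm (y' - S h y) \<le> norm (h *\<^sub>R \<alpha> t y) + norm (S h y + h *\<^sub>R \<alpha> t y - y')"
      by (metis norm_triangle_ineq4)
    also have "\<dots> \<le> h * norm (\<alpha> t y) + h * (\<epsilon> + \<eta> / 2)"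
      using y'(2) h(3) by simp
    also have "\<dots> \<le> h * (norm (\<alpha> t y) + \<epsilon> + \<eta>)"
      using h(3) \<eta> by (simp add: algebra_simps)
    finally show "norm (y' - S h y) \<le> h * (norm (\<alpha> t y) + \<epsilon> + \<eta>)" .
    \<comment> \<open>The four terms are the remainder of the expansion, the transported old
      distance, the change of \<alpha> between the two points, and the defect of tangency.\<close>
    have "\<xi> (t + h) - y' = (\<xi> (t + h) - S h (\<xi> t) - h *\<^sub>R \<alpha> t (\<xi> t)) +
        (S h (\<xi> t - y) + (h *\<^sub>R (\<alpha> t (\<xi> t) - \<alpha> t y) + (S h y + h *\<^sub>R \<alpha> t y - y')))"
      by (simp add: blinfun.diff_right algebra_simps)
    then have "norm (\<xi> (t + h) - y') \<le> norm (\<xi> (t + h) - S h (\<xi> t) - h *\<^sub>R \<alpha> t (\<xi> t)) +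
        (norm (S h (\<xi> t - y)) + (norm (h *\<^sub>R (\<alpha> t (\<xi> t) - \<alpha> t y)) + norm (S h y + h *\<^sub>R \<alpha> t y - y')))"
      by (metis norm_triangle_le norm_triangle_ineq add_left_mono)
    also have "\<dots> \<le> \<eta> / 2 * h + (exp (\<beta> * h) * norm (\<xi> t - y) +
        (h * (l * norm (\<xi> t - y) + b) + h * (\<epsilon> + \<eta> / 2)))"
      using h(2,3) y'(2) norm_S_apply[of h "\<xi> t - y"]
      by (intro add_mono) (auto intro!: mult_left_mono modulus t0)
    also have "\<dots> = (exp (\<beta> * h) + h * l) * norm (\<xi> t - y) + h * (\<epsilon> + b + \<eta>)"
      by (simp add: algebra_simps)
    also have "\<dots> \<le> exp ((\<beta> + l) * h) * norm (\<xi> t - y) + phi (\<beta> + l) h * (\<epsilon> + b + \<eta>)"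
    \<comment> \<open>The one-step factor is enlarged to an exponential and \<open>h\<close> to
      \<open>phi (\<beta> + l) h\<close>, so that any number of steps composes without loss.\<close>
    proof (intro add_mono mult_right_mono)
      have "h * l \<le> exp (\<beta> * h) * (h * l)"
        using h(3) l_nonneg beta_nonneg mult_right_mono[of 1 "exp (\<beta> * h)" "h * l"] by simp
      then have "exp (\<beta> * h) + h * l \<le> exp (\<beta> * h) * (1 + h * l)"
        by (simp add: algebra_simps)
      also have "\<dots> \<le> exp (\<beta> * h) * exp (h * l)"
        by (intro mult_left_mono exp_ge_add_one_self) auto
      also have "\<dots> = exp ((\<beta> + l) * h)"
        by (simp add: algebra_simps flip: exp_add)
      finally show "exp (\<beta> * h) + h * l \<le> exp ((\<beta> + l) * h)" .
      show "h \<le> phi (\<beta> + l) h"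
        using h(3) beta_nonneg l_nonneg by (intro phi_ge) auto
    qed (use eps_nonneg b_nonneg \<eta> in auto)
    finally show "norm (\<xi> (t + h) - y') \<le>
      exp ((\<beta> + l) * h) * norm (\<xi> t - y) + phi (\<beta> + l) h * (\<epsilon> + b + \<eta>)" .
  qed
qed

lemma approximate_trajectory:
  assumes s: "s \<ge> 0" "s \<le> T" and mild: "is_mild_solution S \<alpha> s x \<xi>"
    and y0: "y0 \<in> K" and \<eta>: "\<eta> > 0"
  shows "\<exists>y\<in>K. norm (\<xi> T - y) \<le>
    exp ((\<beta> + l) * (T - s)) * norm (x - y0) + phi (\<beta> + l) (T - s) * (\<epsilon> + b + \<eta>)"
proof -
  let ?\<gamma> = "\<beta> + l"
  \<comment> \<open>This is the solution of
    \<open>E' = (\<beta> + l) * E + (\<epsilon> + b + \<eta>)\<close> starting from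
    \<open>norm (x - y0)\<close> at time \<open>s\<close>; hence \<open>E_add\<close> matches the
    bound of \<open>one_step\<close> exactly.\<close>
  define E where "E t = exp (?\<gamma> * (t - s)) * norm (x - y0) + phi ?\<gamma> (t - s) * (\<epsilon> + b + \<eta>)" for t
  \<comment> \<open>A trajectory is represented by its end point only: the invariant needed for the
    next step does not refer to the past.\<close>
  define V where "V = {z. s \<le> fst z \<and> fst z \<le> T \<and> snd z \<in> K \<and> norm (\<xi> (fst z) - snd z) \<le> E (fst z)}"
  have gamma: "?\<gamma> \<ge> 0" using beta_nonneg l_nonneg by simp
  have cont: "continuous_on {s..} \<xi>" using mild by (simp add: is_mild_solution_def)
  have xi_s: "\<xi> s = x" using mild by (simp add: is_mild_solution_def)
  have E_cont: "continuous_on {s..} E"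
    unfolding E_def by (intro continuous_intros) auto
  have E_mono: "E t \<le> E T" if "s \<le> t" "t \<le> T" for t
    unfolding E_def using that gamma eps_nonneg b_nonneg \<eta>
    by (intro add_mono mult_right_mono phi_mono) (auto intro!: mult_left_mono)
  have E_add: "E (t + h) = exp (?\<gamma> * h) * E t + phi ?\<gamma> h * (\<epsilon> + b + \<eta>)" if "s \<le> t" "0 \<le> h" for t h
  proof -
    have "phi ?\<gamma> (t + h - s) = phi ?\<gamma> h + exp (?\<gamma> * h) * phi ?\<gamma> (t - s)"
      using phi_add[of "t - s" h ?\<gamma>] that by (simp add: algebra_simps)
    moreover have "exp (?\<gamma> * (t + h - s)) = exp (?\<gamma> * h) * exp (?\<gamma> * (t - s))"
      by (simp add: algebra_simps flip: exp_add)
    ultimately show ?thesis by (simp only: E_def) (simp add: algebra_simps)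
  qed
  have "compact (\<xi> ` {s..T})"
    using continuous_on_subset[OF cont] by (intro compact_continuous_image) auto
  then obtain X where X: "\<And>t. s \<le> t \<Longrightarrow> t \<le> T \<Longrightarrow> norm (\<xi> t) \<le> X"
    by (force dest!: compact_imp_bounded simp: bounded_iff)
  \<comment> \<open>Points in \<open>V\<close> lie within \<open>E T\<close> of the bounded image of
    the solution, so linear growth bounds \<alpha> on all of \<open>V\<close> and one rate serves
    every step.\<close>
  define M where "M = C * (1 + (X + E T)) + \<epsilon> + \<eta>"
  have M: "norm (\<alpha> (fst z) (snd z)) + \<epsilon> + \<eta> \<le> M" if z: "z \<in> V" for z
  proof -
    have "norm (snd z) \<le> X + E T"
      using z X[of "fst z"] E_mono[of "fst z"] norm_triangle_ineq4[of "\<xi> (fst z)" "\<xi> (fst z) - snd z"]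
      by (simp add: V_def)
    then have "C * (1 + norm (snd z)) \<le> C * (1 + (X + E T))"
      using C_nonneg by (intro mult_left_mono) auto
    then show ?thesis
      using growth[of "fst z" "snd z"] z s(1) by (simp add: V_def M_def)
  qed
  have start: "(s, y0) \<in> V"
    using s y0 xi_s by (simp add: V_def E_def)
  have "norm (\<alpha> s y0) + \<epsilon> + \<eta> \<le> M" using M[OF start] by simp
  then have M_nonneg: "M \<ge> 0" using eps_nonneg \<eta> norm_ge_zero[of "\<alpha> s y0"] by linarith
  have "\<exists>w\<in>V. fst w = T"
  proof (rule ordering_progress[of "(s, y0)" V "rate_le M"])
    show "(s, y0) \<in> V" by (rule start)
    show "fst z \<le> T" if "z \<in> V" for z using that by (simp add: V_def)
    show "fst z \<le> fst w" if "rate_le M z w" for z w using that by (simp add: rate_le_def)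
  next
    fix z :: "nat \<Rightarrow> real \<times> 'a" assume z: "\<And>n. z n \<in> V" "\<And>n. rate_le M (z n) (z (Suc n))"
    have V: "s \<le> fst (z n)" "fst (z n) \<le> T" "snd (z n) \<in> K" "norm (\<xi> (fst (z n)) - snd (z n)) \<le> E (fst (z n))" for n
      using z(1)[of n] by (auto simp: V_def)
    obtain w where w: "z \<longlonglongrightarrow> w" "\<And>n. rate_le M (z n) w"
      using rate_le_limit[of M z T, OF z(2) V(2) M_nonneg] by blast
    have t_lim: "(\<lambda>n. fst (z n)) \<longlonglongrightarrow> fst w" and y_lim: "(\<lambda>n. snd (z n)) \<longlonglongrightarrow> snd w"
      using w(1) by (auto intro: tendsto_intros)
    have ws: "s \<le> fst w" "fst w \<le> T"
      using LIMSEQ_le_const[OF t_lim] LIMSEQ_le_const2[OF t_lim] V by blast+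
    have lim: "(\<lambda>n. f (fst (z n))) \<longlonglongrightarrow> f (fst w)" if "continuous_on {s..} f" for f :: "real \<Rightarrow> 'c::topological_space"
      using that t_lim by (rule continuous_on_tendsto_compose) (use ws V in auto)
    have "norm (\<xi> (fst w) - snd w) \<le> E (fst w)"
      by (rule LIMSEQ_le[OF tendsto_norm[OF tendsto_diff[OF lim[OF cont] y_lim]] lim[OF E_cont]])
        (use V in blast)
    moreover have "snd w \<in> K"
      using closed_sequentially[OF closed_K _ y_lim] V by blast
    ultimately have "w \<in> V" using ws by (simp add: V_def)
    with w(2) show "\<exists>w\<in>V. \<forall>n. rate_le M (z n) w" by blast
  next
    fix z assume z: "z \<in> V" "fst z < T"
    obtain t y where [simp]: "z = (t, y)" by (cases z)
    have t: "s \<le> t" "t < T" and y: "y \<in> K" "norm (\<xi> t - y) \<le> E t"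
      using z by (auto simp: V_def)
    obtain h y' where h: "h > 0" "t + h \<le> T" "y' \<in> K"
        "norm (y' - S h y) \<le> h * (norm (\<alpha> t y) + \<epsilon> + \<eta>)"
        "norm (\<xi> (t + h) - y') \<le> exp (?\<gamma> * h) * norm (\<xi> t - y) + phi ?\<gamma> h * (\<epsilon> + b + \<eta>)"
      using one_step[OF s(1) mild t y(1) \<eta>] .
    have "h * (norm (\<alpha> t y) + \<epsilon> + \<eta>) \<le> phi \<beta> h * M"
      using h(1) M[OF z(1)] beta_nonneg phi_ge[of \<beta> h] eps_nonneg \<eta>
      by (intro mult_mono) auto
    then have "rate_le M z (t + h, y')"
      using h by (simp add: rate_le_def mult.commute)
    moreover have "norm (\<xi> (t + h) - y') \<le> E (t + h)"
      using h(5) mult_left_mono[OF y(2) exp_ge_zero[of "?\<gamma> * h"]] E_add[OF t(1) less_imp_le[OF h(1)]]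
      by linarith
    then have "(t + h, y') \<in> V"
      using h t by (simp add: V_def)
    ultimately show "\<exists>w\<in>V. rate_le M z w \<and> fst z < fst w"
      using h(1) by (intro bexI[of _ "(t + h, y')"]) auto
  qed (auto intro: rate_le_refl rate_le_trans)
  then show ?thesis by (auto simp: V_def E_def)
qed

lemma infdist_mild_solution_le:
  assumes s: "s \<ge> 0" "s \<le> T" and mild: "is_mild_solution S \<alpha> s x \<xi>"
  shows "infdist (\<xi> T) K \<le>
    exp ((\<beta> + l) * (T - s)) * infdist x K + phi (\<beta> + l) (T - s) * (\<epsilon> + b)"
proof -
  let ?g = "\<lambda>\<eta>. exp ((\<beta> + l) * (T - s)) * (infdist x K + \<eta>) + phi (\<beta> + l) (T - s) * (\<epsilon> + b + \<eta>)"
  have bound: "infdist (\<xi> T) K \<le> ?g \<eta>" if \<eta>: "\<eta> > 0" for \<eta>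
  proof -
    obtain y0 where y0: "y0 \<in> K" "dist x y0 < infdist x K + \<eta>"
      using infdist_lessE[of x K "infdist x K + \<eta>"] \<eta> K_nonempty by auto
    obtain y where y: "y \<in> K" "norm (\<xi> T - y) \<le>
        exp ((\<beta> + l) * (T - s)) * norm (x - y0) + phi (\<beta> + l) (T - s) * (\<epsilon> + b + \<eta>)"
      using approximate_trajectory[OF s mild y0(1) \<eta>] by blast
    have "exp ((\<beta> + l) * (T - s)) * norm (x - y0) \<le> exp ((\<beta> + l) * (T - s)) * (infdist x K + \<eta>)"
      using y0(2) by (intro mult_left_mono) (auto simp: dist_norm)
    then show ?thesis
      using y infdist_le[OF y(1), of "\<xi> T"] unfolding dist_norm by linarith
  qed
  \<comment> \<open>Two losses vanish with \<eta>: the starting point is only nearly nearest to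
    \<open>x\<close>, and every step carries slack.\<close>
  have "(?g \<longlongrightarrow> exp ((\<beta> + l) * (T - s)) * (infdist x K + 0) + phi (\<beta> + l) (T - s) * (\<epsilon> + b + 0)) (at_right 0)"
    by (intro tendsto_intros)
  then have "infdist (\<xi> T) K \<le>
      exp ((\<beta> + l) * (T - s)) * (infdist x K + 0) + phi (\<beta> + l) (T - s) * (\<epsilon> + b + 0)"
  proof (rule tendsto_lowerbound)
    show "eventually (\<lambda>\<eta>. infdist (\<xi> T) K \<le> ?g \<eta>) (at_right 0)"
      unfolding eventually_at_right_field using bound by (intro exI[of _ 1]) auto
  qed simp
  then show ?thesis by simp
qed

end

section \<open>From the distance estimate back to tangency\<close>

context piecewise_autonomous
begin

text \<open>As \<open>x\<close> lies in \<open>K\<close>, the estimate has no initial distance term.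
  The expansion at time \<open>s\<close> replaces the solution by
  \<open>S h x + h *\<^sub>R \<alpha> s x\<close> at a cost of \<open>\<eta> * h\<close>; division
  by \<open>h\<close> leaves \<open>exp (\<gamma> * h) * \<epsilon> + \<eta>\<close>, which tends to
  \<open>\<epsilon> + \<eta>\<close>.\<close>

lemma Liminf_infdist_le:
  assumes s: "s \<ge> 0" and x: "x \<in> K" and mild: "is_mild_solution S \<alpha> s x \<xi>" and \<gamma>: "\<gamma> \<ge> 0" and "\<epsilon> \<ge> 0"
    and bound: "\<And>t. t \<ge> s \<Longrightarrow> infdist (\<xi> t) K \<le> phi \<gamma> (t - s) * \<epsilon>"
  shows "Liminf (at_right 0) (\<lambda>t. ereal (1 / t * infdist (S t x + t *\<^sub>R \<alpha> s x) K)) \<le> ereal \<epsilon>"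
proof (rule ereal_le_epsilon2)
  fix \<eta> :: real assume \<eta>: "\<eta> > 0"
  have xi_s: "\<xi> s = x" using mild by (simp add: is_mild_solution_def)
  let ?g = "\<lambda>h. exp (\<gamma> * h) * \<epsilon> + \<eta>"
  have lim: "((\<lambda>h. ereal (?g h)) \<longlongrightarrow> ereal (exp (\<gamma> * 0) * \<epsilon> + \<eta>)) (at_right 0)"
    by (intro tendsto_intros)
  have "eventually (\<lambda>h::real. h > 0) (at_right 0)"
    by (rule eventually_at_right_less)
  with mild_solution_expansion[OF s mild order_refl \<eta>]
  have "eventually (\<lambda>h. ereal (1 / h * infdist (S h x + h *\<^sub>R \<alpha> s x) K) \<le> ereal (?g h)) (at_right 0)"
  proof eventually_elim
    case (elim h)
    have "infdist (S h x + h *\<^sub>R \<alpha> s x) K \<le> infdist (\<xi> (s + h)) K + dist (S h x + h *\<^sub>R \<alpha> s x) (\<xi> (s + h))"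
      by (rule infdist_triangle)
    moreover have "dist (S h x + h *\<^sub>R \<alpha> s x) (\<xi> (s + h)) \<le> \<eta> * h"
      using elim(1) by (simp add: xi_s dist_norm norm_minus_commute algebra_simps)
    moreover have "infdist (\<xi> (s + h)) K \<le> h * exp (\<gamma> * h) * \<epsilon>"
      using bound[of "s + h"] mult_right_mono[OF phi_le[OF \<gamma>, of h] \<open>\<epsilon> \<ge> 0\<close>] elim(2) by simp
    ultimately have "infdist (S h x + h *\<^sub>R \<alpha> s x) K \<le> h * ?g h"
      by (simp add: algebra_simps)
    then show ?case using elim(2) by (simp add: field_simps)
  qed
  then have "Liminf (at_right 0) (\<lambda>t. ereal (1 / t * infdist (S t x + t *\<^sub>R \<alpha> s x) K)) \<le>
      Liminf (at_right 0) (\<lambda>h. ereal (?g h))"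
    by (rule Liminf_mono)
  also have "\<dots> = ereal (exp (\<gamma> * 0) * \<epsilon> + \<eta>)"
    using lim by (intro lim_imp_Liminf) auto
  finally show "Liminf (at_right 0) (\<lambda>t. ereal (1 / t * infdist (S t x + t *\<^sub>R \<alpha> s x) K)) \<le>
      ereal \<epsilon> + ereal \<eta>"
    by simp
qed

end

theorem theorem3p5:
  fixes S :: "real \<Rightarrow> 'a::banach \<Rightarrow>\<^sub>L 'a"
    and A :: "('a \<times> 'a) set"
    and K :: "'a set"
    and \<alpha> :: "real \<Rightarrow> 'a \<Rightarrow> 'a"
    and \<beta> L C \<epsilon> :: real
    and \<tau> :: "nat \<Rightarrow> real"
    and a :: "nat \<Rightarrow> 'a \<Rightarrow> 'a"
  assumes "C0_semigroup S"
    and "A = infinitesimal_generator S"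
    and "\<beta> \<ge> 0" and "\<And>t. t \<ge> 0 \<Longrightarrow> norm (S t) \<le> exp (\<beta> * t)"
    and "closed K" and "K \<noteq> {}"
    and "(\<lambda>(t, x). \<alpha> t x) \<in> borel_measurable (restrict_space borel ({0..} \<times> UNIV))"
    and "L \<ge> 0" and "C \<ge> 0"
    and "\<And>t x y. t \<ge> 0 \<Longrightarrow> norm (\<alpha> t x - \<alpha> t y) \<le> L * norm (x - y)"
    and "\<And>t x. t \<ge> 0 \<Longrightarrow> norm (\<alpha> t x) \<le> C * (1 + norm x)"
    and "strict_mono \<tau>" and "\<tau> 0 = 0" and "filterlim \<tau> at_top sequentially"
    and "\<And>n t x. t \<in> {\<tau> n..<\<tau> (Suc n)} \<Longrightarrow> \<alpha> t x = a n x"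
    and "\<epsilon> \<ge> 0"
  shows
    "let \<xi> = (\<lambda>t s x. mild_solution S \<alpha> s x t);
         stmt_i = (\<forall>s\<ge>0. \<forall>x\<in>K.
           Liminf (at_right 0) (\<lambda>t. ereal (1 / t * infdist (blinfun_apply (S t) x + t *\<^sub>R \<alpha> s x) K))
             \<le> ereal \<epsilon>);
         stmt_ii = (\<forall>n. \<forall>x\<in>K.
           Liminf (at_right 0) (\<lambda>t. ereal (1 / t * infdist (blinfun_apply (S t) x + t *\<^sub>R a n x) K))
             \<le> ereal \<epsilon>);
         stmt_iii = (\<forall>s t x. 0 \<le> s \<and> s \<le> t \<longrightarrow>
           infdist (\<xi> t s x) K
             \<le> exp ((\<beta> + L) * (t - s)) * infdist x K + phi (\<beta> + L) (t - s) * \<epsilon>)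
     in (stmt_i \<longleftrightarrow> stmt_ii) \<and> (stmt_ii \<longleftrightarrow> stmt_iii) \<and>
        (stmt_i \<and> stmt_ii \<and> stmt_iii \<longrightarrow>
          (\<forall>B\<ge>0. (\<forall>t\<ge>0. \<forall>x. norm (\<alpha> t x) \<le> B) \<longrightarrow>
            (\<forall>s t x. 0 \<le> s \<and> s \<le> t \<longrightarrow>
              infdist (\<xi> t s x) K
                \<le> exp (\<beta> * (t - s)) * infdist x K + phi \<beta> (t - s) * (\<epsilon> + 2 * B))))"
proof -
  interpret piecewise_autonomous S \<beta> \<alpha> L C \<tau> a
    by unfold_locales (use assms in blast)+
  define quot where
    "quot v x = (\<lambda>t. ereal (1 / t * infdist (blinfun_apply (S t) x + t *\<^sub>R v) K))" for v x
  define stmt_i where "stmt_i \<longleftrightarrow> (\<forall>s\<ge>0. \<forall>x\<in>K. Liminf (at_right 0) (quot (\<alpha> s x) x) \<le> ereal \<epsilon>)"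
  define stmt_ii where "stmt_ii \<longleftrightarrow> (\<forall>n. \<forall>x\<in>K. Liminf (at_right 0) (quot (a n x) x) \<le> ereal \<epsilon>)"
  define stmt_iii where "stmt_iii \<longleftrightarrow> (\<forall>s t x. 0 \<le> s \<and> s \<le> t \<longrightarrow>
    infdist (mild_solution S \<alpha> s x t) K
      \<le> exp ((\<beta> + L) * (t - s)) * infdist x K + phi (\<beta> + L) (t - s) * \<epsilon>)"
  define stmt_bounded where "stmt_bounded \<longleftrightarrow> (\<forall>B\<ge>0. (\<forall>t\<ge>0. \<forall>x. norm (\<alpha> t x) \<le> B) \<longrightarrow>
    (\<forall>s t x. 0 \<le> s \<and> s \<le> t \<longrightarrow> infdist (mild_solution S \<alpha> s x t) K
      \<le> exp (\<beta> * (t - s)) * infdist x K + phi \<beta> (t - s) * (\<epsilon> + 2 * B)))"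
  have i_ii: "stmt_i \<longleftrightarrow> stmt_ii"
  proof
    assume stmt_i
    then show stmt_ii
      unfolding stmt_i_def stmt_ii_def a_eq using tau_nonneg by blast
  next
    assume ii: stmt_ii
    show stmt_i
      unfolding stmt_i_def
    proof (intro allI impI ballI)
      fix s :: real and x assume "s \<ge> 0" "x \<in> K"
      moreover obtain n where "s \<in> {\<tau> n..<\<tau> (Suc n)}" using interval_index[OF \<open>s \<ge> 0\<close>] .
      ultimately show "Liminf (at_right 0) (quot (\<alpha> s x) x) \<le> ereal \<epsilon>"
        using ii by (simp add: stmt_ii_def alpha_eq[of s n])
    qed
  qed
  have tangent: "Liminf (at_right 0) (\<lambda>t. ereal (1 / t * infdist (S t x + t *\<^sub>R \<alpha> s x) K)) \<le> ereal \<epsilon>"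
    if stmt_i "s \<ge> 0" "x \<in> K" for s x
    using that unfolding stmt_i_def quot_def by blast
  have i_iii: "stmt_i \<longleftrightarrow> stmt_iii"
  proof
    assume i: stmt_i
    interpret nearly_tangent S \<beta> \<alpha> L C \<tau> a K \<epsilon> L 0
      by unfold_locales (use assms tangent[OF i] lipschitz in auto)
    show stmt_iii
      using infdist_mild_solution_le[OF _ _ is_mild_solution_mild_solution] by (simp add: stmt_iii_def)
  next
    assume iii: stmt_iii
    show stmt_i
      unfolding stmt_i_def quot_def
    proof (intro allI impI ballI)
      fix s :: real and x assume s: "s \<ge> 0" and x: "x \<in> K"
      show "Liminf (at_right 0) (\<lambda>t. ereal (1 / t * infdist (S t x + t *\<^sub>R \<alpha> s x) K)) \<le> ereal \<epsilon>"
      proof (rule Liminf_infdist_le[OF s x is_mild_solution_mild_solution[OF s]])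
        show "infdist (mild_solution S \<alpha> s x t) K \<le> phi (\<beta> + L) (t - s) * \<epsilon>" if "t \<ge> s" for t
          using iii[unfolded stmt_iii_def, rule_format, of s t x] s that x by simp
      qed (use beta_nonneg L_nonneg \<open>\<epsilon> \<ge> 0\<close> in auto)
    qed
  qed
  have bounded: stmt_bounded if i: stmt_i
    unfolding stmt_bounded_def
  proof (intro allI impI)
    fix B s t :: real and x :: 'a
    assume B: "0 \<le> B" "\<forall>t\<ge>0. \<forall>x. norm (\<alpha> t x) \<le> B" and st: "0 \<le> s \<and> s \<le> t"
    have "norm (\<alpha> t x - \<alpha> t y) \<le> 2 * B" if "t \<ge> 0" for t x y
      using norm_triangle_ineq4[of "\<alpha> t x" "\<alpha> t y"] B(2) that by (smt (verit))
    then interpret nearly_tangent S \<beta> \<alpha> L C \<tau> a K \<epsilon> 0 "2 * B"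
      by unfold_locales (use assms tangent[OF i] B(1) in auto)
    show "infdist (mild_solution S \<alpha> s x t) K
        \<le> exp (\<beta> * (t - s)) * infdist x K + phi \<beta> (t - s) * (\<epsilon> + 2 * B)"
      using infdist_mild_solution_le[OF _ _ is_mild_solution_mild_solution] st by simp
  qed
  have "(stmt_i \<longleftrightarrow> stmt_ii) \<and> (stmt_ii \<longleftrightarrow> stmt_iii) \<and> (stmt_i \<and> stmt_ii \<and> stmt_iii \<longrightarrow> stmt_bounded)"
    using i_ii i_iii bounded by blast
  then show ?thesis
    unfolding Let_def stmt_i_def stmt_ii_def stmt_iii_def stmt_bounded_def quot_def .
qed

end
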